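(* Let $Q$ be a quasiorder and let $X$ be a quasi-Polish space. Then: (a) $X$ satisfies the Hausdorff-Kuratowski theorem for $Q$-partitions in every successor level $1+\alpha+1<\omega_1$, i.e. for every $\alpha<\omega_1$, $\bigcup\{\mathcal{L}(X,T)\mid T\in\mathcal{T}_{\alpha+1}(Q)\}=\mathbf{\Delta}^0_{1+\alpha+1}(Q^X)$; (b) $X$ satisfies the Wadge property for $Q$-partitions in every limit level $\lambda<\omega_1$, i.e. for every (nonzero) limit ordinal $\lambda<\omega_1$, $\bigcup\{\mathcal{L}(X,T)\mid T\in\mathcal{T}_{\lambda}(Q)\}=\mathbf{\Delta}^0_{\lambda}(Q^X)$.
   Context: Trees. $\omega^*$ is the set of finite strings over $\omega$, $\varepsilon$ the empty string, $\sqsubseteq$ the prefix order. A tree is a non-empty prefix-closed $T\subseteq\omega^*$; it is well founded if it has no infinite path, and infinite-branching if every non-leaf $\tau\in T$ has $\tau i\in T$ for all $i<\omega$. Terms. For a quasiorder $Q$, $\mathbb{T}_\sigma$ is the set of variable-free terms defined inductively from constants $q\in Q$, unary symbols $s_\alpha$ ($\alpha<\omega_1$) and $\omega$-ary symbols $F_q$ ($q\in Q$) and $F_\alpha$ ($\alpha<\omega_1$), all symbols being distinct. To each $u\in\mathbb{T}_\sigma$ one associates an infinite-branching well founded tree $T$ with a labeling $t$ of its nodes by terms, written $T(u)=(T,t)$: $T(q)$ and $T(s_\alpha(u))$ are the one-node tree $\{\varepsilon\}$ labeled by $q$, resp. by $s_\alpha(u)$; $T(F_q(u_0,u_1,\ldots))$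 has root labeled $q$, and its labeled subtree above the node $i$ is $T(u_i)$ for each $i\ge0$; $T(F_\alpha(u_0,u_1,\ldots))$ has root labeled $s_\alpha(u_0)$, and its labeled subtree above the node $i$ is $T(u_{i+1})$ for each $i\ge0$. Terms and their trees are identified, so $\mathcal{L}(X,T(u))$ means $\mathcal{L}(X,u)$ (defined below). The sets $\mathcal{T}_\alpha(Q)$. $\mathcal{T}_0(Q)=Q$ (constant terms). For $\gamma<\omega_1$, $\mathcal{T}_{\omega^\gamma}(Q)$ is the set of (trees of) terms using only the symbols $q,s_\delta,F_q,F_\delta$ with $q\in Q$, $\delta<\gamma$. For $\alpha=\omega^{\alpha_0}+\cdots+\omega^{\alpha_n}$ with $\alpha_0\ge\cdots\ge\alpha_n$, $\mathcal{T}_\alpha=\mathcal{T}_{\omega^{\alpha_0}}\circ\cdots\circ\mathcal{T}_{\omega^{\alpha_n}}$; for $n\ge1$ and $\beta=\omega^{\alpha_1}+\cdots+\omega^{\alpha_n}$, an element of $\mathcal{T}_{\omega^{\alpha_0}}(\mathcal{T}_\beta(Q))$ is regarded as an element of $\mathbb{T}_\sigma$ by reading (recursively) each constant $p\in\mathcal{T}_\beta(Q)$ as $s_{\alpha_0}(p)$ and each $F_p(u_0,u_1,\ldots)$ with $p\in\mathcal{T}_\beta(Q)$ as $F_{\alpha_0}(p,u_0,u_1,\ldots)$. Bases. A base in a set $X$ is a sequence $\mathcal{L}(X)=\{\mathcal{L}_\alpha(X)\}_{\alpha<\omega_1}$ of subsets of $P(X)$, each closed under countable unions and finite intersections (in particular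 containing $\emptyset$ and $X$), such that for $\alpha<\beta$ all sets of $\mathcal{L}_\alpha$ and their complements belong to $\mathcal{L}_\beta$. The $\beta$-shift is the base $\mathcal{L}^\beta(X)=\{\mathcal{L}_{\beta+\alpha}(X)\}_{\alpha<\omega_1}$; for $U\subseteq X$, the $U$-restriction $\mathcal{L}(U)$ is the base in $U$ with levels $\{U\cap S\mid S\in\mathcal{L}_\alpha(X)\}$. Here $\mathcal{L}(X)$ is the Borel base $\{\mathbf{\Sigma}^0_{1+\alpha}(X)\}_{\alpha<\omega_1}$, where $\mathbf{\Sigma}^0_1$ is the class of open sets, $\mathbf{\Sigma}^0_2$ the class of countable unions of differences of open sets, and, for $\alpha>2$, $\mathbf{\Sigma}^0_\alpha$ the class of countable unions of complements of sets in $\bigcup_{\beta<\alpha}\mathbf{\Sigma}^0_\beta$. $\mathbf{\Delta}^0_\alpha(X)$ is the class of sets which, together with their complements, are in $\mathbf{\Sigma}^0_\alpha(X)$, and $\mathbf{\Delta}^0_\alpha(Q^X)$ is the set of $A:X\to Q$ with $A^{-1}(q)\in\mathbf{\Delta}^0_\alpha(X)$ for all $q\in Q$. Families. For a well founded tree $T$, a $T$-family $\{U_\tau\}_{\tau\in T}$ of subsets of $X$ is monotone if $U_\tau\supseteq U_{\tau'}$ whenever $\tau\sqsubseteq\tau'$ in $T$; its components are $\tilde U_\tau=U_\tau\setminus\bigcup\{U_{\tau'}\mid\tau\sqsubset\tau'\in T\}$. The notions "$F$ is a $u$-family in $\mathcal{L}(X)$" and "$F$ determines $A:X\to Q$" are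 defined by induction, simultaneously for all bases: (i) the only $q$-family is $\{X\}$, and it determines exactly the constant function $\lambda x.q$; (ii) an $s_\alpha(u)$-family in $\mathcal{L}(X)$ is a $u$-family in $\mathcal{L}^{\omega^\alpha}(X)$, and it determines $A$ iff it determines $A$ as a $u$-family in $\mathcal{L}^{\omega^\alpha}(X)$; (iii) if $u=F_q(u_0,\ldots)$ or $u=F_\alpha(u_0,\ldots)$ and $T(u)=(T,t)$, a $u$-family is a pair $(\{U_\tau\}_{\tau\in T},\{F_\tau\}_{\tau\in T})$ where $\{U_\tau\}$ is a monotone $T$-family of $\mathcal{L}_0(X)$-sets with $U_\varepsilon=X$ and each $F_\tau$ is a $t(\tau)$-family in $\mathcal{L}(\tilde U_\tau)$; it determines $A$ iff $F_\tau$ determines $A|_{\tilde U_\tau}$ for every $\tau\in T$. $\mathcal{L}(X,u)$ is the set of all $A:X\to Q$ determined by some $u$-family in $\mathcal{L}(X)$. Quasi-Polish spaces. A quasi-Polish space is a space homeomorphic to a $\mathbf{\Pi}^0_2$-subspace (complement of a $\mathbf{\Sigma}^0_2$-set) of $P(\omega)$ with the Scott topology, whose basic open sets are $\{A\subseteq\omega\mid F\subseteq A\}$, $F\subseteq\omega$ finite.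
   Formalization: Q is taken non-empty, and both right-hand sides are restricted to those A with countable range: for uncountable Q the equalities fail as stated (X the Cantor space, Q its set of points, A the identity); for countable Q nothing changes. *)

theory Defs
  imports "HOL-Analysis.Analysis" "HOL-Library.Countable_Set_Type" "HOL-Library.Sublist"
begin

section \<open>Countable ordinals\<close>

text \<open>The type of ordinals below \<open>\<omega>\<^sub>1\<close>: \<^term>\<open>cardSuc natLeq\<close> is a well-order of type
  \<open>\<omega>\<^sub>1\<close>. In it every proper initial segment is countable, and every countable set is bounded
  (lemmas \<open>countable_below\<close> and \<open>countable_bounded\<close>).\<close>

typedef omega1 = "Field (cardSuc natLeq)"
proof -
  have "infinite (Field (cardSuc natLeq))"
    using cardSuc_finite[OF natLeq_Card_order] by (simp add: Field_natLeq)
  then show ?thesis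
    by (metis ex_in_conv finite.emptyI)
qed

lemma Well_order_cardSuc_natLeq: "Well_order (cardSuc natLeq)"
  by (rule cardSuc_Well_order[OF natLeq_Card_order])

instantiation omega1 :: wellorder
begin

definition less_eq_omega1 :: "omega1 \<Rightarrow> omega1 \<Rightarrow> bool" where
  "a \<le> b \<longleftrightarrow> (Rep_omega1 a, Rep_omega1 b) \<in> cardSuc natLeq"

definition less_omega1 :: "omega1 \<Rightarrow> omega1 \<Rightarrow> bool" where
  "(a :: omega1) < b \<longleftrightarrow> a \<le> b \<and> a \<noteq> b"

instance
proof -
  let ?r = "cardSuc natLeq"
  have wo: "Well_order ?r" by (rule Well_order_cardSuc_natLeq)
  have refl: "Refl ?r" and trans: "trans ?r" and antisym: "antisym ?r" and tot: "Total ?r"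
    and wf: "wf (?r - Id)"
    using wo by (auto simp: order_on_defs)
  have rep: "Rep_omega1 x \<in> Field ?r" for x by (rule Rep_omega1)
  have r: "x \<le> x" for x :: omega1
    using refl rep by (auto simp: less_eq_omega1_def refl_on_def)
  have as: "x = y" if "x \<le> y" "y \<le> x" for x y :: omega1
    using that antisym unfolding less_eq_omega1_def antisym_def
    by (metis Rep_omega1_inject)
  have tr: "x \<le> z" if "x \<le> y" "y \<le> z" for x y z :: omega1
    using that trans by (auto simp: less_eq_omega1_def intro: transD)
  have to: "x \<le> y \<or> y \<le> x" for x y :: omega1
    using tot rep refl r unfolding total_on_def less_eq_omega1_def
    by (metis Rep_omega1_inject)
  have wf': "wf {(x, y :: omega1). x < y}"
  proof (rule wf_subset[OF wf_inv_image[OF wf, of Rep_omega1]])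
    show "{(x, y). x < y} \<subseteq> inv_image (?r - Id) Rep_omega1"
      by (auto simp: less_omega1_def less_eq_omega1_def inv_image_def Rep_omega1_inject)
  qed
  show "OFCLASS(omega1, wellorder_class)"
  proof
    fix P :: "omega1 \<Rightarrow> bool" and a
    assume "\<And>x. (\<And>y. y < x \<Longrightarrow> P y) \<Longrightarrow> P x"
    then show "P a" using wf_induct[OF wf', of P a] by auto
  qed (use r as tr to in \<open>auto simp: less_omega1_def\<close>)
qed

end

lemma countable_below:
  includes cardinal_syntax
  shows "countable {b :: omega1. b \<le> a}"
proof -
  let ?r = "cardSuc natLeq"
  have "|underS ?r (Rep_omega1 a)| <o ?r"
    by (rule card_of_underS[OF cardSuc_Card_order[OF natLeq_Card_order] Rep_omega1])
  then have "|underS ?r (Rep_omega1 a)| \<le>o natLeq"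
    using cardSuc_ordLeq_ordLess[OF natLeq_Card_order card_of_Card_order] by blast
  then have "countable (underS ?r (Rep_omega1 a))"
    by (simp add: countable_card_le_natLeq)
  moreover have "Rep_omega1 ` {b. b < a} \<subseteq> underS ?r (Rep_omega1 a)"
    by (auto simp: underS_def less_omega1_def less_eq_omega1_def Rep_omega1_inject)
  ultimately have "countable (Rep_omega1 ` {b. b < a})"
    using countable_subset by blast
  then have "countable {b. b < a}"
    by (rule countable_image_inj_on) (meson Rep_omega1_inject inj_onI)
  moreover have "{b. b \<le> a} = insert a {b. b < a}" by auto
  ultimately show ?thesis by simp
qed

lemma uncountable_omega1:
  includes cardinal_syntax
  shows "uncountable (UNIV :: omega1 set)"
proof
  assume "countable (UNIV :: omega1 set)"
  then have "countable (range Rep_omega1)" by blast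
  then have "countable (Field (cardSuc natLeq))"
    by (simp add: type_definition.Rep_range[OF type_definition_omega1])
  then have "|Field (cardSuc natLeq)| \<le>o natLeq"
    by (simp add: countable_card_le_natLeq)
  then have "cardSuc natLeq \<le>o natLeq"
    using card_of_Field_ordIso[OF cardSuc_Card_order[OF natLeq_Card_order]]
      ordIso_ordLeq_trans ordIso_symmetric by blast
  then show False
    using cardSuc_greater[OF natLeq_Card_order] not_ordLess_ordLeq by blast
qed

lemma countable_bounded:
  fixes A :: "omega1 set"
  assumes "countable A"
  shows "\<exists>c. \<forall>a\<in>A. a < c"
proof (rule ccontr)
  assume "\<not> ?thesis"
  then have "UNIV = (\<Union>a\<in>A. {b. b \<le> a})" by (force simp: not_less)
  then show False
    using assms uncountable_omega1 countable_below countable_UN by metis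
qed

text \<open>Addition, multiplication and exponentiation with base \<open>\<omega>\<close> are defined by the usual
  transfinite recursion on the second argument, the zero, successor and limit clauses being
  merged into one: \<open>a + b = sup {a, (a + b') + 1 | b' < b}\<close>,
  \<open>a * b = sup {a * b' + a | b' < b}\<close> and
  \<open>\<omega>\<^sup>b = sup {1, \<omega>\<^sup>b\<^sup>' * \<omega> | b' < b}\<close>.\<close>

function ord_add :: "omega1 \<Rightarrow> omega1 \<Rightarrow> omega1" where
  "ord_add a b = (LEAST c. a \<le> c \<and> (\<forall>d \<in> (\<lambda>b'. ord_add a b') ` {b'. b' < b}. d < c))"
  by auto
termination
  by (relation "inv_image {(x, y). x < y} snd") (auto intro: wf wf_inv_image)

declare ord_add.simps [simp del]

instantiation omega1 :: "{zero, one, plus}"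
begin

definition zero_omega1 :: omega1 where "(0 :: omega1) = (LEAST a. True)"
definition one_omega1 :: omega1 where "(1 :: omega1) = (LEAST a. 0 < a)"
definition plus_omega1 :: "omega1 \<Rightarrow> omega1 \<Rightarrow> omega1" where "(a :: omega1) + b = ord_add a b"

instance ..

end

function ord_mult :: "omega1 \<Rightarrow> omega1 \<Rightarrow> omega1" where
  "ord_mult a b = (LEAST c. \<forall>d \<in> (\<lambda>b'. ord_mult a b') ` {b'. b' < b}. d + a \<le> c)"
  by auto
termination
  by (relation "inv_image {(x, y). x < y} snd") (auto intro: wf wf_inv_image)

declare ord_mult.simps [simp del]

instantiation omega1 :: times
begin

definition times_omega1 :: "omega1 \<Rightarrow> omega1 \<Rightarrow> omega1" where "(a :: omega1) * b = ord_mult a b"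

instance ..

end

definition is_limit :: "omega1 \<Rightarrow> bool" where
  "is_limit l \<longleftrightarrow> 0 < l \<and> (\<forall>b<l. b + 1 < l)"

definition omega :: omega1 where
  "omega = (LEAST l. is_limit l)"

function omega_pow :: "omega1 \<Rightarrow> omega1" where
  "omega_pow b = (LEAST c. 1 \<le> c \<and> (\<forall>d \<in> omega_pow ` {b'. b' < b}. d * omega \<le> c))"
  by auto
termination
  by (relation "{(x, y). x < y}") (auto intro: wf)

declare omega_pow.simps [simp del]

lemma omega1_LeastI:
  fixes P :: "omega1 \<Rightarrow> bool"
  assumes "countable A" and "\<And>c. (\<And>a. a \<in> A \<Longrightarrow> a < c) \<Longrightarrow> P c"
  shows "P (LEAST c. P c)"
  using countable_bounded[OF assms(1)] assms(2) by (metis LeastI)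

lemma countable_lessThan_omega1: "countable {b :: omega1. b < a}"
  by (rule countable_subset[OF _ countable_below[of a]]) auto

lemma omega1_zero_le [simp]: "(0 :: omega1) \<le> a"
  unfolding zero_omega1_def by (rule Least_le) simp

lemma omega1_not_less_zero [simp]: "\<not> (a :: omega1) < 0"
  by (simp add: not_less)

lemma omega1_zero_less_one: "(0 :: omega1) < 1"
  unfolding one_omega1_def by (rule omega1_LeastI[of "{0}"]) auto

lemma omega1_one_le_iff: "(1 :: omega1) \<le> a \<longleftrightarrow> 0 < a"
proof
  show "1 \<le> a \<Longrightarrow> 0 < a" using omega1_zero_less_one by order
  show "0 < a \<Longrightarrow> 1 \<le> a" unfolding one_omega1_def by (rule Least_le)
qed

lemma omega1_less_one_iff: "(a :: omega1) < 1 \<longleftrightarrow> a = 0"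
  using omega1_one_le_iff[of a] by (metis not_less omega1_zero_le order.antisym)

lemma omega1_add_rec: "(a :: omega1) + b = (LEAST c. a \<le> c \<and> (\<forall>b'<b. a + b' < c))"
  unfolding plus_omega1_def by (subst ord_add.simps) simp

lemma omega1_mult_rec: "(a :: omega1) * b = (LEAST c. \<forall>b'<b. a * b' + a \<le> c)"
  unfolding times_omega1_def by (subst ord_mult.simps) simp

lemma omega_pow_rec: "omega_pow b = (LEAST c. 1 \<le> c \<and> (\<forall>b'<b. omega_pow b' * omega \<le> c))"
  by (subst omega_pow.simps) simp

lemma omega1_add_rec_props: "(a :: omega1) \<le> a + b \<and> (\<forall>b'<b. a + b' < a + b)"
  unfolding omega1_add_rec[of a b]
  by (rule omega1_LeastI[of "insert a ((+) a ` {b'. b' < b})"])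
    (auto simp: countable_lessThan_omega1 less_imp_le)

lemma omega1_mult_rec_props: "\<forall>b'<b. (a :: omega1) * b' + a \<le> a * b"
  unfolding omega1_mult_rec[of a b]
  by (rule omega1_LeastI[of "(\<lambda>b'. a * b' + a) ` {b'. b' < b}"])
    (auto simp: countable_lessThan_omega1 less_imp_le)

lemma omega_pow_rec_props: "1 \<le> omega_pow b \<and> (\<forall>b'<b. omega_pow b' * omega \<le> omega_pow b)"
  unfolding omega_pow_rec[of b]
  by (rule omega1_LeastI[of "insert 1 ((\<lambda>b'. omega_pow b' * omega) ` {b'. b' < b})"])
    (auto simp: countable_lessThan_omega1 less_imp_le)

lemma omega1_add_0 [simp]: "(a :: omega1) + 0 = a"
  unfolding omega1_add_rec[of a 0] by (rule Least_equality) auto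

lemma omega1_less_add_one: "(a :: omega1) < a + 1"
  using omega1_add_rec_props[of a 1] omega1_zero_less_one by force

lemma omega1_add_one_le_iff: "(a :: omega1) + 1 \<le> b \<longleftrightarrow> a < b"
proof
  show "a + 1 \<le> b \<Longrightarrow> a < b" using omega1_less_add_one[of a] by order
  show "a + 1 \<le> b" if "a < b"
    unfolding omega1_add_rec[of a 1] using that
    by (intro Least_le) (auto simp: omega1_less_one_iff)
qed

lemma omega1_less_add_one_iff: "(a :: omega1) < b + 1 \<longleftrightarrow> a \<le> b"
  using omega1_add_one_le_iff[of b a] by (simp add: not_le[symmetric])

lemma omega1_add_mono: "(a :: omega1) + b \<le> a + c" if "b \<le> c"
  using that omega1_add_rec_props[of a c] by (cases "b = c") (auto simp: less_le)

lemma omega1_add_succ: "(a :: omega1) + (b + 1) = (a + b) + 1"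
proof (rule order.antisym)
  show "(a + b) + 1 \<le> a + (b + 1)"
    using omega1_add_rec_props[of a "b + 1"] omega1_less_add_one[of b]
    by (simp add: omega1_add_one_le_iff)
  have "a \<le> (a + b) + 1"
    using omega1_add_rec_props[of a b] omega1_less_add_one[of "a + b"] by (meson order.trans less_imp_le)
  then show "a + (b + 1) \<le> (a + b) + 1"
    unfolding omega1_add_rec[of a "b + 1"]
    by (intro Least_le) (auto simp: omega1_less_add_one_iff omega1_add_mono)
qed

lemma omega1_mult_0 [simp]: "(a :: omega1) * 0 = 0"
  unfolding omega1_mult_rec[of a 0] by (rule Least_equality) auto

lemma omega1_mult_mono: "(a :: omega1) * b \<le> a * c" if "b \<le> c"
  unfolding omega1_mult_rec[of a b] using that omega1_mult_rec_props[of c a]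
  by (intro Least_le) auto

lemma omega1_add_mono_left: "(a :: omega1) + c \<le> b + c" if "a \<le> b"
proof (induction c rule: less_induct)
  case (less c)
  show ?case
    unfolding omega1_add_rec[of a c]
    using that omega1_add_rec_props[of b c] less by (intro Least_le) (meson order.trans order.strict_trans1)
qed

lemma omega1_mult_succ: "(a :: omega1) * (b + 1) = a * b + a"
proof (rule order.antisym)
  show "a * b + a \<le> a * (b + 1)"
    using omega1_mult_rec_props[of "b + 1" a] omega1_less_add_one[of b] by simp
  show "a * (b + 1) \<le> a * b + a"
    unfolding omega1_mult_rec[of a "b + 1"]
    by (intro Least_le)
      (auto simp: omega1_less_add_one_iff omega1_add_mono_left omega1_mult_mono)
qed

lemma omega_pow_0 [simp]: "omega_pow 0 = 1"
  unfolding omega_pow_rec[of 0] by (rule Least_equality) auto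

lemma omega_pow_mono: "omega_pow b \<le> omega_pow c" if "b \<le> c"
  unfolding omega_pow_rec[of b] using that omega_pow_rec_props[of c]
  by (intro Least_le) auto

lemma omega1_zero_add [simp]: "0 + (b :: omega1) = b"
proof (induction b rule: less_induct)
  case (less b)
  have "b \<le> y" if "\<forall>b'<b. 0 + b' < y" for y
    using that less by (metis not_less order.irrefl)
  then show ?case
    unfolding omega1_add_rec[of 0 b] using less by (intro Least_equality) auto
qed

lemma omega1_mult_mono_left: "(a :: omega1) * c \<le> b * c" if "a \<le> b"
proof (induction c rule: less_induct)
  case (less c)
  have "a * c' + a \<le> b * c" if "c' < c" for c'
    using omega1_mult_rec_props[of c b] omega1_add_mono_left[OF less[OF that], of a]
      omega1_add_mono[OF \<open>a \<le> b\<close>, of "b * c'"] that by (meson order.trans)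
  then show ?case
    unfolding omega1_mult_rec[of a c] by (intro Least_le) auto
qed

lemma is_limit_omega: "is_limit omega"
proof -
  define f where "f n = ((\<lambda>a. a + 1) ^^ n) (0 :: omega1)" for n
  have fS: "f (Suc n) = f n + 1" for n by (simp add: f_def)
  obtain c0 where c0: "\<forall>a\<in>range f. a < c0" using countable_bounded[of "range f"] by auto
  define c where "c = (LEAST c. \<forall>a\<in>range f. a < c)"
  have c: "f n < c" for n
    unfolding c_def using LeastI[of "\<lambda>c. \<forall>a\<in>range f. a < c", OF c0] by blast
  have "b + 1 < c" if "b < c" for b
  proof -
    have "\<exists>n. b \<le> f n"
      using that not_less_Least[of b "\<lambda>c. \<forall>a\<in>range f. a < c"] unfolding c_def
      by (auto simp: not_less)
    then obtain n where "b \<le> f n" by blast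
    then have "b + 1 \<le> f (Suc n)"
      by (simp add: fS omega1_add_one_le_iff omega1_less_add_one_iff)
    then show ?thesis using c[of "Suc n"] by order
  qed
  moreover have "0 < c" using c[of 0] omega1_zero_le[of "f 0"] by order
  ultimately have "is_limit c" by (auto simp: is_limit_def)
  then show ?thesis unfolding omega_def by (rule LeastI)
qed

lemma omega_pow_succ: "omega_pow (b + 1) = omega_pow b * omega"
proof (rule order.antisym)
  show "omega_pow b * omega \<le> omega_pow (b + 1)"
    using omega_pow_rec_props[of "b + 1"] omega1_less_add_one[of b] by simp
  have "0 < omega" "0 + 1 < omega" using is_limit_omega by (auto simp: is_limit_def)
  then have "omega_pow b * 0 + omega_pow b \<le> omega_pow b * omega"
    using omega1_mult_rec_props[of omega "omega_pow b"] by blast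
  then have "1 \<le> omega_pow b * omega"
    using omega_pow_rec_props[of b] by (metis omega1_mult_0 omega1_zero_add order.trans)
  then show "omega_pow (b + 1) \<le> omega_pow b * omega"
    unfolding omega_pow_rec[of "b + 1"]
    by (intro Least_le) (auto simp: omega1_less_add_one_iff omega1_mult_mono_left omega_pow_mono)
qed

text \<open>\<open>cantor_nf \<alpha> [\<alpha>\<^sub>0, \<dots>, \<alpha>\<^sub>n]\<close> holds iff
  \<open>\<alpha> = \<omega>\<^bsup>\<alpha>\<^sub>0\<^esup> + \<dots> + \<omega>\<^bsup>\<alpha>\<^sub>n\<^esup>\<close> with \<open>\<alpha>\<^sub>0 \<ge> \<dots> \<ge> \<alpha>\<^sub>n\<close>; the empty list represents \<open>0\<close>.\<close>

definition cantor_nf :: "omega1 \<Rightarrow> omega1 list \<Rightarrow> bool" where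
  "cantor_nf a es \<longleftrightarrow> sorted_wrt (\<ge>) es \<and> a = foldr (\<lambda>e b. omega_pow e + b) es 0"

section \<open>Terms and their labeled trees\<close>

text \<open>\<open>Const q\<close>, \<open>Sh \<alpha> u\<close>, \<open>FQ q us\<close>, \<open>FO \<alpha> us\<close> stand for the terms \<open>q\<close>, \<open>s\<^sub>\<alpha>(u)\<close>,
  \<open>F\<^sub>q(u\<^sub>0, u\<^sub>1, \<dots>)\<close> and \<open>F\<^sub>\<alpha>(u\<^sub>0, u\<^sub>1, \<dots>)\<close>.\<close>

datatype 'q trm =
    Const 'q
  | Sh omega1 "'q trm"
  | FQ 'q "nat \<Rightarrow> 'q trm"
  | FO omega1 "nat \<Rightarrow> 'q trm"

primrec nodes :: "'q trm \<Rightarrow> nat list set" where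
  "nodes (Const q) = {[]}"
| "nodes (Sh a u) = {[]}"
| "nodes (FQ q us) = insert [] (\<Union>i. (#) i ` nodes (us i))"
| "nodes (FO a us) = insert [] (\<Union>i. (#) i ` nodes (us (Suc i)))"

primrec label :: "'q trm \<Rightarrow> nat list \<Rightarrow> 'q trm" where
  "label (Const q) = (\<lambda>_. Const q)"
| "label (Sh a u) = (\<lambda>_. Sh a u)"
| "label (FQ q us) = (\<lambda>t. case t of [] \<Rightarrow> Const q | i # t' \<Rightarrow> label (us i) t')"
| "label (FO a us) = (\<lambda>t. case t of [] \<Rightarrow> Sh a (us 0) | i # t' \<Rightarrow> label (us (Suc i)) t')"

section \<open>The sets of terms indexed by countable ordinals\<close>

text \<open>\<open>omega_terms g P\<close> is \<open>T\<^bsub>\<omega>\<^sup>g\<^esub>(P)\<close>.\<close>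

inductive_set omega_terms :: "omega1 \<Rightarrow> 'p set \<Rightarrow> 'p trm set" for g :: omega1 and P :: "'p set" where
  "p \<in> P \<Longrightarrow> Const p \<in> omega_terms g P"
| "d < g \<Longrightarrow> u \<in> omega_terms g P \<Longrightarrow> Sh d u \<in> omega_terms g P"
| "p \<in> P \<Longrightarrow> (\<And>i. us i \<in> omega_terms g P) \<Longrightarrow> FQ p us \<in> omega_terms g P"
| "d < g \<Longrightarrow> (\<And>i. us i \<in> omega_terms g P) \<Longrightarrow> FO d us \<in> omega_terms g P"

text \<open>Terms over terms are read as terms: a constant \<open>p\<close> becomes \<open>s\<^sub>a(p)\<close>, and
  \<open>F\<^sub>p(u\<^sub>0, u\<^sub>1, \<dots>)\<close> becomes \<open>F\<^sub>a(p, u\<^sub>0, u\<^sub>1, \<dots>)\<close>.\<close>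

primrec flatten :: "omega1 \<Rightarrow> 'q trm trm \<Rightarrow> 'q trm" where
  "flatten a (Const p) = Sh a p"
| "flatten a (Sh d u) = Sh d (flatten a u)"
| "flatten a (FQ p us) = FO a (case_nat p (\<lambda>i. flatten a (us i)))"
| "flatten a (FO d us) = FO d (\<lambda>i. flatten a (us i))"

fun nf_terms :: "omega1 list \<Rightarrow> 'q trm set" where
  "nf_terms [] = range Const"
| "nf_terms [e] = omega_terms e UNIV"
| "nf_terms (e # e' # es) = flatten e ` omega_terms e (nf_terms (e' # es))"

text \<open>\<open>T\<^sub>\<alpha>(Q)\<close>, where \<open>Q\<close> is the (whole) type \<^typ>\<open>'q\<close>; the list \<open>es\<close> is the Cantor normal form
  of \<open>\<alpha>\<close>.\<close>

definition terms_at :: "omega1 \<Rightarrow> 'q trm set" where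
  "terms_at a = (\<Union>es \<in> {es. cantor_nf a es}. nf_terms es)"

section \<open>Bases\<close>

text \<open>A base in a set is given by its levels; the carrier set is passed separately.\<close>

type_synonym 'x base = "omega1 \<Rightarrow> 'x set set"

definition shift :: "omega1 \<Rightarrow> 'x base \<Rightarrow> 'x base" where
  "shift b L = (\<lambda>a. L (b + a))"

definition restrict_base :: "'x set \<Rightarrow> 'x base \<Rightarrow> 'x base" where
  "restrict_base U L = (\<lambda>a. (\<lambda>S. U \<inter> S) ` L a)"

text \<open>\<open>sigma0 X a\<close> is the class \<open>\<Sigma>\<^sup>0\<^sub>a(X)\<close> for \<open>a \<ge> 1\<close>; it is empty for \<open>a = 0\<close>. Since the
  empty set and the whole space belong to level \<open>1\<close>, countable unions may be indexed by \<open>nat\<close>.\<close>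

inductive sigma0 :: "'x topology \<Rightarrow> omega1 \<Rightarrow> 'x set \<Rightarrow> bool" for X :: "'x topology" where
  "openin X U \<Longrightarrow> sigma0 X 1 U"
| "(\<And>n::nat. openin X (U n)) \<Longrightarrow> (\<And>n. openin X (V n)) \<Longrightarrow> sigma0 X (1 + 1) (\<Union>n. U n - V n)"
| "1 + 1 < a \<Longrightarrow> (\<And>n::nat. \<exists>b<a. sigma0 X b (B n)) \<Longrightarrow> sigma0 X a (\<Union>n. topspace X - B n)"

definition delta0 :: "'x topology \<Rightarrow> omega1 \<Rightarrow> 'x set \<Rightarrow> bool" where
  "delta0 X a S \<longleftrightarrow> sigma0 X a S \<and> sigma0 X a (topspace X - S)"

text \<open>Functions on a set \<open>Y\<close> are represented by the members of \<open>Y \<rightarrow>\<^sub>E UNIV\<close>. The next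
  definition is \<open>\<Delta>\<^sup>0\<^sub>a(Q\<^sup>X)\<close>, where \<open>Q\<close> is the type \<^typ>\<open>'q\<close>. For uncountable \<open>Q\<close> it may contain functions
  with uncountable range (e.g. the identity on the Cantor space, for \<open>Q\<close> its set of points),
  whereas a function determined by a term always has countable range.\<close>

definition delta0_partitions :: "'x topology \<Rightarrow> omega1 \<Rightarrow> ('x \<Rightarrow> 'q) set" where
  "delta0_partitions X a =
     {A \<in> topspace X \<rightarrow>\<^sub>E UNIV. \<forall>q. delta0 X a {x \<in> topspace X. A x = q}}"

definition borel_base :: "'x topology \<Rightarrow> 'x base" where
  "borel_base X = (\<lambda>a. {S. sigma0 X (1 + a) S})"

section \<open>Families\<close>

definition monotone_family :: "nat list set \<Rightarrow> (nat list \<Rightarrow> 'x set) \<Rightarrow> bool" where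
  "monotone_family T U \<longleftrightarrow> (\<forall>s\<in>T. \<forall>t\<in>T. prefix s t \<longrightarrow> U t \<subseteq> U s)"

definition component :: "nat list set \<Rightarrow> (nat list \<Rightarrow> 'x set) \<Rightarrow> nat list \<Rightarrow> 'x set" where
  "component T U s = U s - (\<Union>t \<in> {t \<in> T. strict_prefix s t}. U t)"

text \<open>Raw families: \<open>Whole X\<close> is the family \<open>{X}\<close> and \<open>Node U F\<close> is the pair
  \<open>({U\<^sub>\<tau>}, {F\<^sub>\<tau>})\<close>, of which only the values at nodes \<open>\<tau>\<close> of the tree are relevant.\<close>

datatype 'x family =
    Whole "'x set"
  | Node "nat list \<Rightarrow> 'x set" "nat list \<Rightarrow> 'x family"

definition branching :: "'q trm \<Rightarrow> bool" where
  "branching u \<longleftrightarrow> (\<exists>q us. u = FQ q us) \<or> (\<exists>a us. u = FO a us)"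

text \<open>\<open>is_family u X L F\<close>: \<open>F\<close> is a \<open>u\<close>-family in the base \<open>L\<close> in \<open>X\<close>. The recursion is well
  founded since labels are constants or of the form \<open>s\<^sub>\<alpha>(v)\<close> with \<open>v\<close> a proper subterm of \<open>u\<close>.\<close>

inductive is_family :: "'q trm \<Rightarrow> 'x set \<Rightarrow> 'x base \<Rightarrow> 'x family \<Rightarrow> bool" where
  "is_family (Const q) X L (Whole X)"
| "is_family u X (shift (omega_pow a) L) F \<Longrightarrow> is_family (Sh a u) X L F"
| "branching u \<Longrightarrow> monotone_family (nodes u) U \<Longrightarrow> (\<forall>t\<in>nodes u. U t \<in> L 0) \<Longrightarrow> U [] = X \<Longrightarrow>
   (\<And>t. t \<in> nodes u \<Longrightarrow>
      is_family (label u t) (component (nodes u) U t)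
        (restrict_base (component (nodes u) U t) L) (F t)) \<Longrightarrow>
   is_family u X L (Node U F)"

text \<open>\<open>determines u X L F A\<close>: the \<open>u\<close>-family \<open>F\<close> in the base \<open>L\<close> in \<open>X\<close> determines \<open>A\<close>.\<close>

inductive determines ::
  "'q trm \<Rightarrow> 'x set \<Rightarrow> 'x base \<Rightarrow> 'x family \<Rightarrow> ('x \<Rightarrow> 'q) \<Rightarrow> bool" where
  "determines (Const q) X L (Whole X) (\<lambda>x\<in>X. q)"
| "determines u X (shift (omega_pow a) L) F A \<Longrightarrow> determines (Sh a u) X L F A"
| "branching u \<Longrightarrow>
   (\<And>t. t \<in> nodes u \<Longrightarrow>
      determines (label u t) (component (nodes u) U t)
        (restrict_base (component (nodes u) U t) L) (F t)
        (restrict A (component (nodes u) U t))) \<Longrightarrow>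
   determines u X L (Node U F) A"

definition determined :: "'x topology \<Rightarrow> 'q trm \<Rightarrow> ('x \<Rightarrow> 'q) set" where
  "determined X u =
     {A \<in> topspace X \<rightarrow>\<^sub>E UNIV.
        \<exists>F. is_family u (topspace X) (borel_base X) F \<and>
            determines u (topspace X) (borel_base X) F A}"

section \<open>Quasi-Polish spaces\<close>

definition scott_powerset :: "nat set topology" where
  "scott_powerset = topology_generated_by {{A. F \<subseteq> A} |F. finite F}"

definition quasi_polish :: "'x topology \<Rightarrow> bool" where
  "quasi_polish X \<longleftrightarrow>
     (\<exists>S. sigma0 scott_powerset (1 + 1) (UNIV - S) \<and>
          X homeomorphic_space subtopology scott_powerset S)"

end

theory Submission
  imports Defs
begin

text \<open>
  Both parts are instances of one statement: for every \<open>\<alpha> > 0\<close>, the functions determined by terms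
  of \<open>\<T>\<^sub>\<alpha>\<close> are the functions with countable range all of whose fibres are in
  \<open>\<Sigma>\<^sup>0\<^bsub>1+\<alpha>\<^esub>\<close>. A successor \<open>\<alpha> + 1\<close> gives the Hausdorff-Kuratowski theorem, and a limit \<open>\<lambda>\<close>
  gives the Wadge property, because \<open>1 + \<lambda> = \<lambda>\<close>.

  A term bounds the level of the functions that it determines by induction on the term, for all
  bases at once: \<open>s\<^sub>\<delta>\<close> shifts the base by \<open>\<omega>\<^sup>\<delta>\<close>, this shift is absorbed by the leading term
  \<open>\<omega>\<^sup>\<epsilon>\<close> of \<open>\<alpha>\<close> when \<open>\<delta> < \<epsilon>\<close>, and branching only glues pieces along sets of level \<open>0\<close>
  (lemma \<open>has_level_nf_terms\<close>).

  For the converse write \<open>\<alpha> = \<beta> + \<omega>\<^sup>\<gamma>\<close>, where \<open>\<omega>\<^sup>\<gamma>\<close> is the last summand of the Cantor normal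
  form. The operations \<open>s\<close> of the other summands shift the base by \<open>\<beta>\<close>, so it suffices to find
  a term of \<open>\<T>\<^bsub>\<omega>\<^sup>\<gamma>\<^esub>\<close> in the base \<open>\<L>\<^sup>\<beta>\<close>. Call \<open>Y \<subseteq> X\<close> realisable if such a term
  exists for \<open>A\<close> restricted to \<open>Y\<close>. Sets on which \<open>A\<close> is constant are realisable, and
  realisability is preserved by splitting a set along one set of a level below \<open>1 + \<alpha>\<close>
  (\<open>realisable_split\<close>) and by countable unions of pieces cut out by sets of a fixed such level
  (\<open>realisable_UN\<close>).

  Suppose that \<open>X\<close> itself is not realisable. Then for every covering of the kinds just described
  each unrealisable set meets some member of the covering in an unrealisable set. Running through
  countably many coverings gives a decreasing sequence of unrealisable sets, which generates a
  filter (\<open>generic_filter\<close>). The coverings can be chosen to make the filter decide membership in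
  any countably many given sets of levels below \<open>1 + \<alpha>\<close>, with a witness for each countable union
  that it accepts. Since \<open>X\<close> is a \<open>\<Pi>\<^sup>0\<^sub>2\<close> subspace of \<open>P(\<omega>)\<close>, the basic open sets accepted by
  the filter are those of a point \<open>x\<close> of \<open>X\<close>, and by induction on the Borel level the filter
  accepts exactly the decided sets that contain \<open>x\<close> (\<open>settled_sigma0\<close>). But the fibre of \<open>A\<close>
  through \<open>x\<close> is a countable union of decided sets, so \<open>A\<close> is constant on one of the
  unrealisable sets, a contradiction. This argument by a single point takes the place of both the
  Baire category theorem and refinements of the topology.
\<close>
section \<open>Ordinal arithmetic\<close>

lemma ord_add_less_mono: "a + b < a + c" if "b < c" for a b c :: omega1
  using that omega1_add_rec_props[of a c] by auto

lemma ord_le_add_left: "b \<le> a + b" for a b :: omega1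
  using omega1_add_mono_left[of 0 a b] by simp

lemma ord_add_least: "a + b \<le> c" if "a \<le> c" "\<And>b'. b' < b \<Longrightarrow> a + b' < c" for a b c :: omega1
  unfolding omega1_add_rec[of a b] using that by (intro Least_le) auto

text \<open>Addition is continuous in its second argument: what lies below \<open>a + b\<close> is already reached
  by some \<open>a + b'\<close>.\<close>

lemma ord_add_approx: "x < a \<or> (\<exists>b'<b. x \<le> a + b')" if "x < a + b" for a b x :: omega1
  using that ord_add_least[of a x b] by (meson not_le)

lemma ord_add_assoc: "(a + b) + c = a + (b + c)" for a b c :: omega1
proof (induction c rule: less_induct)
  case (less c)
  show ?case
  proof (rule order.antisym)
    show "a + b + c \<le> a + (b + c)"
      using less omega1_add_rec_props[of b c]
        omega1_add_rec_props[of a "b + c"]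
      by (intro ord_add_least) (auto intro: omega1_add_mono ord_add_less_mono)
    show "a + (b + c) \<le> a + b + c"
    proof (rule ord_add_least)
      show "a \<le> a + b + c"
        using omega1_add_rec_props order.trans by metis
      fix x assume "x < b + c"
      then consider "x < b" | c' where "c' < c" "x \<le> b + c'"
        using ord_add_approx by blast
      then show "a + x < a + b + c"
      proof cases
        case 1
        then show ?thesis
          using ord_add_less_mono[of x b a] omega1_add_rec_props[of "a + b" c]
          by (meson order.strict_trans2)
      next
        case 2
        then have "a + x \<le> a + b + c'"
          using less omega1_add_mono[of x "b + c'" a] by simp
        then show ?thesis
          using ord_add_less_mono[OF 2(1), of "a + b"] by order
      qed
    qed
  qed
qed

lemma ord_diff_exists: "\<exists>c. a + c = b" if "a \<le> b" for a b :: omega1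
proof -
  define c where "c = (LEAST c. b \<le> a + c)"
  have c: "b \<le> a + c" unfolding c_def by (rule LeastI[of _ b]) (rule ord_le_add_left)
  have "a + c' < b" if "c' < c" for c'
    using that not_less_Least unfolding c_def by (metis not_le)
  then have "a + c \<le> b" using \<open>a \<le> b\<close> by (intro ord_add_least)
  with c show ?thesis by (metis order.antisym)
qed

lemma one_add_limit: "1 + l = l" if "is_limit l"
proof (rule order.antisym)
  have *: "1 + b \<le> b + 1" for b :: omega1
  proof (induction b rule: less_induct)
    case (less b)
    show ?case
    proof (rule ord_add_least)
      show "1 \<le> b + 1" by (rule ord_le_add_left)
      show "1 + b' < b + 1" if "b' < b" for b'
        using less[OF that] that omega1_add_one_le_iff omega1_less_add_one
        by (metis order.strict_trans1 order.trans)
    qed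
  qed
  show "1 + l \<le> l"
  proof (rule ord_add_least)
    show "1 \<le> l" using that by (simp add: is_limit_def omega1_one_le_iff)
    show "1 + b < l" if "b < l" for b
      using that \<open>is_limit l\<close> *[of b] unfolding is_limit_def by (meson order.strict_trans1)
  qed
qed (rule ord_le_add_left)

lemma omega_induct [consumes 1, case_names zero succ]:
  assumes "n < omega" "P 0" "\<And>m. m < omega \<Longrightarrow> P m \<Longrightarrow> P (m + 1)"
  shows "P n"
  using \<open>n < omega\<close>
proof (induction n rule: less_induct)
  case (less n)
  have "\<not> is_limit n"
    using less.prems not_less_Least unfolding omega_def by blast
  then consider "n = 0" | b where "b < n" "n \<le> b + 1"
    unfolding is_limit_def by (metis not_less omega1_zero_le order.antisym)
  then show ?case
  proof cases
    case 2
    then have "n = b + 1" by (meson omega1_add_one_le_iff order.antisym)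
    with less assms 2 show ?thesis by (metis order.strict_trans)
  qed (use assms in simp)
qed

lemma ord_mult_omega_least: "a * omega \<le> c" if "\<And>n. n < omega \<Longrightarrow> a * (n + 1) \<le> c" for a c :: omega1
  unfolding omega1_mult_rec[of a omega] using that by (intro Least_le) (simp add: omega1_mult_succ)

lemma ord_mult_1 [simp]: "a * 1 = a" for a :: omega1
  using omega1_mult_succ[of a 0] by simp

lemma ord_mult_succ_left: "a + a * n = a * (n + 1)" if "n < omega" for a n :: omega1
  using that
proof (induction rule: omega_induct)
  case (succ m)
  then show ?case by (simp add: omega1_mult_succ flip: ord_add_assoc)
qed (simp add: omega1_mult_succ)

text \<open>Adding \<open>a\<close> on the left only moves \<open>a \<cdot> n\<close> to \<open>a \<cdot> (n + 1)\<close>, which does not change the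
  supremum over the finite \<open>n\<close>.\<close>

lemma ord_mult_omega_absorb: "a + a * omega = a * omega" for a :: omega1
proof (rule order.antisym[OF ord_add_least ord_le_add_left])
  have S: "n + 1 < omega" if "n < omega" for n
    using that is_limit_omega by (simp add: is_limit_def)
  have "0 < omega" using is_limit_omega by (simp add: is_limit_def)
  then show "a \<le> a * omega"
    using omega1_mult_rec_props[of omega a] by fastforce
  fix x assume "x < a * omega"
  then obtain n where n: "n < omega" "x < a * (n + 1)"
    using ord_mult_omega_least[of a x] by (meson not_le)
  have "a + x < a + a * (n + 1)" using n by (intro ord_add_less_mono)
  also have "\<dots> = a * (n + 1 + 1)" using n S by (simp add: ord_mult_succ_left)
  also have "\<dots> \<le> a * omega"
    using n S by (intro omega1_mult_mono) (simp add: less_imp_le)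
  finally show "a + x < a * omega" .
qed

lemma omega_pow_absorb: "omega_pow d + omega_pow e = omega_pow e" if "d < e"
proof -
  obtain c where "omega_pow d * omega + c = omega_pow e"
    using omega_pow_rec_props[of e] \<open>d < e\<close> ord_diff_exists by blast
  then show ?thesis by (metis ord_add_assoc ord_mult_omega_absorb)
qed

lemma omega_pow_approx:
  assumes "x < omega_pow g" "0 < x"
  obtains d where "d < g" "x < omega_pow d * omega"
proof -
  have "x < (LEAST c. 1 \<le> c \<and> (\<forall>d<g. omega_pow d * omega \<le> c))"
    using assms by (simp flip: omega_pow_rec)
  then have "\<not> (1 \<le> x \<and> (\<forall>d<g. omega_pow d * omega \<le> x))"
    by (rule not_less_Least)
  then show ?thesis using assms that by (metis not_le omega1_one_le_iff)
qed

lemma less_omega_pow_mult_omega: "omega_pow d < omega_pow d * omega"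
proof -
  have "0 < omega" "0 + 1 < omega" using is_limit_omega by (auto simp: is_limit_def)
  then have "omega_pow d * (0 + 1) + omega_pow d \<le> omega_pow d * omega"
    using omega1_mult_rec_props by blast
  moreover have "0 < omega_pow d" using omega_pow_rec_props[of d] by (simp add: omega1_one_le_iff)
  ultimately show ?thesis
    using ord_add_less_mono[of 0 "omega_pow d" "omega_pow d"]
    by simp
qed

lemma le_omega_pow: "e \<le> omega_pow e"
proof (induction e rule: less_induct)
  case (less e)
  have "d < omega_pow e" if "d < e" for d
    using less[OF that] less_omega_pow_mult_omega[of d] omega_pow_rec_props[of e] that by fastforce
  then show ?case by (meson not_le order.irrefl)
qed

text \<open>The ordinal whose Cantor normal form is \<open>es\<close> if \<open>es\<close> is decreasing; other lists occur as
  lists of indices of iterated \<open>s\<close>-symbols.\<close>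

definition sum_pows :: "omega1 list \<Rightarrow> omega1" where
  "sum_pows es = foldr (\<lambda>e b. omega_pow e + b) es 0"

lemma sum_pows_Nil [simp]: "sum_pows [] = 0"
  and sum_pows_Cons [simp]: "sum_pows (e # es) = omega_pow e + sum_pows es"
  by (simp_all add: sum_pows_def)

lemma sum_pows_append: "sum_pows (es @ fs) = sum_pows es + sum_pows fs"
  by (induction es) (simp_all add: ord_add_assoc)

text \<open>Iterating the symbols \<open>s\<^sub>\<delta>\<close> with \<open>\<delta> < \<gamma>\<close> reaches shifts beyond every ordinal below
  \<open>\<omega>\<^sup>\<gamma>\<close>.\<close>

lemma sum_pows_cofinal:
  assumes "x < omega_pow g"
  obtains ds where "set ds \<subseteq> {..<g}" "x \<le> sum_pows ds"
proof (cases "0 < x")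
  case False
  then have "x = 0" using omega1_zero_le[of x] by order
  then show ?thesis using that[of "[]"] by simp
next
  case True
  then obtain d where d: "d < g" "x < omega_pow d * omega"
    using omega_pow_approx assms by blast
  then obtain n where n: "n < omega" "x < omega_pow d * (n + 1)"
    using ord_mult_omega_least[of "omega_pow d" x] by (meson not_le)
  have S: "n + 1 < omega" using n is_limit_omega by (simp add: is_limit_def)
  have "\<exists>ds. set ds \<subseteq> {d} \<and> omega_pow d * (n + 1) = sum_pows ds"
    using S
  proof (induction rule: omega_induct)
    case zero
    then show ?case by (intro exI[of _ "[]"]) simp
  next
    case (succ m)
    then obtain ds where "set ds \<subseteq> {d}" "omega_pow d * m = sum_pows ds" by blast
    then show ?case using succ
      by (intro exI[of _ "d # ds"]) (simp flip: ord_mult_succ_left)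
  qed
  then show ?thesis using d n that by (metis insert_subset lessThan_iff less_imp_le empty_subsetI subset_trans)
qed

text \<open>The leading exponent is the \<open>e\<close> with \<open>\<omega>\<^sup>e \<le> a < \<omega>\<^sup>e \<cdot> \<omega>\<close>. The remainder is smaller than
  \<open>a\<close>, as otherwise \<open>\<omega>\<^sup>e + a = a\<close> would put all \<open>\<omega>\<^sup>e \<cdot> n\<close> below \<open>a\<close>.\<close>

lemma cantor_nf_exists: "\<exists>es. cantor_nf a es"
proof (induction a rule: less_induct)
  case (less a)
  show ?case
  proof (cases "a = 0")
    case True
    then show ?thesis by (intro exI[of _ "[]"]) (simp add: cantor_nf_def)
  next
    case False
    then have pos: "0 < a" using omega1_zero_le[of a] by order
    define e0 where "e0 = (LEAST e. a < omega_pow e)"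
    have "a < omega_pow (a + 1)"
      using le_omega_pow[of "a + 1"] omega1_less_add_one[of a] by order
    then have "a < omega_pow e0" unfolding e0_def by (rule LeastI)
    then obtain e where e: "e < e0" "a < omega_pow e * omega"
      using omega_pow_approx pos by blast
    then have le: "omega_pow e \<le> a" using not_less_Least unfolding e0_def by (metis not_le)
    then obtain b where b: "omega_pow e + b = a" using ord_diff_exists by blast
    have "b \<noteq> a"
    proof
      assume "b = a"
      have "omega_pow e * n \<le> a" if "n < omega" for n
        using that
      proof (induction rule: omega_induct)
        case (succ m)
        then show ?case
          using omega1_add_mono[of "omega_pow e * m" a "omega_pow e"] b \<open>b = a\<close>
          by (simp flip: ord_mult_succ_left)
      qed simp
      then have "omega_pow e * omega \<le> a"
        using is_limit_omega by (intro ord_mult_omega_least) (simp add: is_limit_def)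
      with e show False by order
    qed
    then have "b < a" using ord_le_add_left[of b "omega_pow e"] b by order
    then obtain es where es: "cantor_nf b es" using less by blast
    have "f \<le> e" if f: "f \<in> set es" for f
    proof (rule ccontr)
      assume "\<not> f \<le> e"
      then have "omega_pow e * omega \<le> omega_pow f" using omega_pow_rec_props[of f] by simp
      also have "\<dots> \<le> b"
      proof -
        obtain fs gs where "es = fs @ f # gs" using split_list[OF f] by blast
        then have "b = sum_pows fs + (omega_pow f + sum_pows gs)"
          using es by (simp add: cantor_nf_def sum_pows_append flip: sum_pows_def)
        then show ?thesis
          using ord_le_add_left[of _ "sum_pows fs"] omega1_add_rec_props[of "omega_pow f"]
          by (metis order.trans)
      qed
      finally show False using e \<open>b < a\<close> by order
    qed
    with es b have "cantor_nf a (e # es)" by (simp add: cantor_nf_def)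
    then show ?thesis by blast
  qed
qed

section \<open>Bases\<close>

definition base_on :: "'x set \<Rightarrow> 'x base \<Rightarrow> bool" where
  "base_on Y L \<longleftrightarrow>
     (\<forall>a. L a \<subseteq> Pow Y \<and> {} \<in> L a \<and> Y \<in> L a) \<and>
     (\<forall>a. \<forall>S :: nat \<Rightarrow> 'x set. range S \<subseteq> L a \<longrightarrow> \<Union>(range S) \<in> L a) \<and>
     (\<forall>a. \<forall>S\<in>L a. \<forall>S'\<in>L a. S \<inter> S' \<in> L a) \<and>
     (\<forall>a b. a < b \<longrightarrow> (\<forall>S\<in>L a. S \<in> L b \<and> Y - S \<in> L b))"

lemma base_onI:
  assumes "\<And>a S. S \<in> L a \<Longrightarrow> S \<subseteq> Y" "\<And>a. {} \<in> L a" "\<And>a. Y \<in> L a"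
    "\<And>a S :: nat \<Rightarrow> 'x set. (\<And>n. S n \<in> L a) \<Longrightarrow> (\<Union>n. S n) \<in> L a"
    "\<And>a S S'. S \<in> L a \<Longrightarrow> S' \<in> L a \<Longrightarrow> S \<inter> S' \<in> L a"
    "\<And>a b S. a < b \<Longrightarrow> S \<in> L a \<Longrightarrow> S \<in> L b" "\<And>a b S. a < b \<Longrightarrow> S \<in> L a \<Longrightarrow> Y - S \<in> L b"
  shows "base_on Y L"
  unfolding base_on_def using assms by (auto simp: range_subsetD)

lemma base_onD:
  assumes "base_on Y L"
  shows "\<And>a S. S \<in> L a \<Longrightarrow> S \<subseteq> Y" "\<And>a. {} \<in> L a" "\<And>a. Y \<in> L a"
    "\<And>a S :: nat \<Rightarrow> 'x set. (\<And>n. S n \<in> L a) \<Longrightarrow> (\<Union>n. S n) \<in> L a"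
    "\<And>a S S'. S \<in> L a \<Longrightarrow> S' \<in> L a \<Longrightarrow> S \<inter> S' \<in> L a"
    "\<And>a b S. a \<le> b \<Longrightarrow> S \<in> L a \<Longrightarrow> S \<in> L b" "\<And>a b S. a < b \<Longrightarrow> S \<in> L a \<Longrightarrow> Y - S \<in> L b"
proof -
  show "S \<in> L b" if "a \<le> b" "S \<in> L a" for a b S
    using assms that unfolding base_on_def by (metis order.order_iff_strict)
  show "(\<Union>n. S n) \<in> L a" if "\<And>n. S n \<in> L a" for a and S :: "nat \<Rightarrow> _"
    using assms that unfolding base_on_def by (meson image_subsetI)
qed (use assms in \<open>auto simp: base_on_def\<close>)

lemma base_on_Un:
  assumes "base_on Y L" "S \<in> L a" "S' \<in> L a"
  shows "S \<union> S' \<in> L a"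
proof -
  have "S \<union> S' = (\<Union>n::nat. if n = 0 then S else S')" by (auto split: if_splits)
  also have "\<dots> \<in> L a" using assms by (intro base_onD(4)[OF assms(1)]) auto
  finally show ?thesis .
qed

lemma base_on_shift: "base_on Y (shift b L)" if "base_on Y L"
  unfolding shift_def
proof (rule base_onI)
  note L = base_onD[OF that]
  show "S \<in> L (b + c)" if "a < c" "S \<in> L (b + a)" for a c S
    using that ord_add_less_mono[of a c b] L(6) by (meson less_imp_le)
  show "Y - S \<in> L (b + c)" if "a < c" "S \<in> L (b + a)" for a c S
    using that ord_add_less_mono[of a c b] L(7) by blast
qed (use base_onD(1-5)[OF that] in simp_all)

lemma shift_shift: "shift c (shift b L) = shift (b + c) L"
  by (simp add: shift_def ord_add_assoc)

lemma shift_0 [simp]: "shift 0 L = L"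
  by (simp add: shift_def)

lemma shift_restrict: "shift b (restrict_base U L) = restrict_base U (shift b L)"
  by (simp add: shift_def restrict_base_def)

lemma restrict_base_twice: "restrict_base V (restrict_base U L) = restrict_base V L" if "V \<subseteq> U"
proof -
  have "V \<inter> (U \<inter> S) = V \<inter> S" for S using that by auto
  then show ?thesis by (simp add: restrict_base_def image_image)
qed

lemma restrict_self: "restrict_base Y L = L" if "base_on Y L"
proof
  fix a
  have "Y \<inter> S = S" if "S \<in> L a" for S using base_onD(1)[OF \<open>base_on Y L\<close> that] by auto
  then show "restrict_base Y L a = L a" by (simp add: restrict_base_def)
qed

lemma base_on_restrict: "base_on U (restrict_base U L)" if "base_on Y L" "U \<subseteq> Y"
proof (rule base_onI)
  note L = base_onD[OF \<open>base_on Y L\<close>]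
  fix a
  show "S \<subseteq> U" if "S \<in> restrict_base U L a" for S using that by (auto simp: restrict_base_def)
  show "{} \<in> restrict_base U L a" using L(2)[of a] by (auto simp: restrict_base_def image_iff)
  show "U \<in> restrict_base U L a" using L(3)[of a] \<open>U \<subseteq> Y\<close> by (auto simp: restrict_base_def image_iff)
  show "(\<Union>n. S n) \<in> restrict_base U L a" if "\<And>n. S n \<in> restrict_base U L a" for S :: "nat \<Rightarrow> _"
  proof -
    have "\<forall>n. \<exists>R. R \<in> L a \<and> S n = U \<inter> R" using that by (auto simp: restrict_base_def)
    then obtain R where R: "\<And>n. R n \<in> L a" "\<And>n. S n = U \<inter> R n" by metis
    have "(\<Union>n. R n) \<in> L a" using R by (intro L(4))
    moreover have "(\<Union>n. S n) = U \<inter> (\<Union>n. R n)" by (simp add: R)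
    ultimately show ?thesis unfolding restrict_base_def by blast
  qed
  show "S \<inter> S' \<in> restrict_base U L a"
    if S: "S \<in> restrict_base U L a" "S' \<in> restrict_base U L a" for S S'
  proof -
    obtain R R' where R: "R \<in> L a" "R' \<in> L a" "S = U \<inter> R" "S' = U \<inter> R'"
      using S unfolding restrict_base_def by blast
    then have "S \<inter> S' = U \<inter> (R \<inter> R')" by auto
    then show ?thesis using R L(5) unfolding restrict_base_def by blast
  qed
  fix b S assume ab: "a < b" and "S \<in> restrict_base U L a"
  then obtain R where R: "R \<in> L a" "S = U \<inter> R" by (auto simp: restrict_base_def)
  show "S \<in> restrict_base U L b"
    using R ab L(6)[of a b R] by (auto simp: restrict_base_def)
  have "U - S = U \<inter> (Y - R)" using R \<open>U \<subseteq> Y\<close> by auto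
  then show "U - S \<in> restrict_base U L b"
    using R ab L(7)[of a b R] by (auto simp: restrict_base_def)
qed

lemma base_of_restrict: "S \<in> L a" if "base_on Y L" "U \<in> L a" "S \<in> restrict_base U L a"
  using that base_onD(5)[OF that(1)] by (auto simp: restrict_base_def)

subsection \<open>The Borel base\<close>

text \<open>Without assumptions on the space, open sets need not be countable unions of closed sets.
  This is why level \<open>2\<close> consists of unions of differences of open sets, and why the lemmas
  below treat the levels \<open>1\<close>, \<open>2\<close> and those above separately.\<close>

lemma sigma0_ge_1: "1 \<le> a" if "sigma0 X a S"
  using that
proof cases
  case 3
  then show ?thesis using omega1_less_add_one[of 1] by order
qed (use omega1_less_add_one[of 1] in auto)

lemma omega1_level_cases [consumes 1, case_names one two more]:
  fixes a :: omega1
  assumes "1 \<le> a"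
  obtains "a = 1" | "a = 1 + 1" | "1 + 1 < a"
proof -
  consider "1 + 1 < a" | "1 + 1 = a" | "a < 1 + 1" by (metis not_less_iff_gr_or_eq)
  then show thesis using that assms omega1_less_add_one_iff[of a 1] by cases auto
qed

lemma sigma0_1_iff: "sigma0 X 1 S \<longleftrightarrow> openin X S"
proof
  assume "sigma0 X 1 S"
  then show "openin X S"
    by cases (use omega1_less_add_one[of 1] in auto)
qed (rule sigma0.intros)

lemma sigma0_2_iff:
  "sigma0 X (1 + 1) S \<longleftrightarrow>
     (\<exists>U V. (\<forall>n::nat. openin X (U n) \<and> openin X (V n)) \<and> S = (\<Union>n. U n - V n))"
proof
  assume "sigma0 X (1 + 1) S"
  then show "\<exists>U V. (\<forall>n::nat. openin X (U n) \<and> openin X (V n)) \<and> S = (\<Union>n. U n - V n)"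
  proof cases
    case (2 U V)
    then show ?thesis by (intro exI[of _ U] exI[of _ V] conjI allI) simp_all
  qed (use omega1_less_add_one[of 1] in simp_all)
next
  assume "\<exists>U V. (\<forall>n::nat. openin X (U n) \<and> openin X (V n)) \<and> S = (\<Union>n. U n - V n)"
  then show "sigma0 X (1 + 1) S" by (elim exE conjE) (simp only: sigma0.intros(2))
qed

lemma sigma0_2E:
  assumes "sigma0 X (1 + 1) S"
  obtains U V where "\<And>n::nat. openin X (U n)" "\<And>n. openin X (V n)" "S = (\<Union>n. U n - V n)"
proof -
  from assms[unfolded sigma0_2_iff] obtain U V where
    "(\<forall>n::nat. openin X (U n) \<and> openin X (V n)) \<and> S = (\<Union>n. U n - V n)"
    by (elim exE)
  then show thesis by (intro that[of U V]) simp_all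
qed

lemma sigma0_gt_2_iff:
  assumes "1 + 1 < a"
  shows "sigma0 X a S \<longleftrightarrow>
     (\<exists>B. (\<forall>n::nat. \<exists>b<a. sigma0 X b (B n)) \<and> S = (\<Union>n. topspace X - B n))"
proof
  assume "sigma0 X a S"
  then show "\<exists>B. (\<forall>n::nat. \<exists>b<a. sigma0 X b (B n)) \<and> S = (\<Union>n. topspace X - B n)"
  proof cases
    case (3 B)
    then show ?thesis by (intro exI[of _ B] conjI allI) simp_all
  qed (use omega1_less_add_one[of 1] assms in simp_all)
next
  assume "\<exists>B. (\<forall>n::nat. \<exists>b<a. sigma0 X b (B n)) \<and> S = (\<Union>n. topspace X - B n)"
  then show "sigma0 X a S" by (elim exE conjE) (simp only: sigma0.intros(3) assms)
qed

lemma sigma0_gt_2E: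
  assumes "sigma0 X a S" "1 + 1 < a"
  obtains B where "\<And>n::nat. \<exists>b<a. sigma0 X b (B n)" "S = (\<Union>n. topspace X - B n)"
proof -
  from assms(1)[unfolded sigma0_gt_2_iff[OF assms(2)]] obtain B where
    "(\<forall>n::nat. \<exists>b<a. sigma0 X b (B n)) \<and> S = (\<Union>n. topspace X - B n)"
    by (elim exE)
  then show thesis by (intro that[of B]) simp_all
qed

lemma sigma0_subset: "S \<subseteq> topspace X" if "sigma0 X a S"
  using that by cases (auto dest: openin_subset)

lemma sigma0_compl:
  assumes "sigma0 X a S" "a < b"
  shows "sigma0 X b (topspace X - S)"
proof -
  have "1 \<le> a" using sigma0_ge_1 assms by blast
  then have "1 \<le> b" using assms by order
  then show ?thesis
  proof (cases rule: omega1_level_cases)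
    case two
    then have "openin X S"
      using assms \<open>1 \<le> a\<close> omega1_less_add_one_iff[of a 1] sigma0_1_iff by (metis order.antisym)
    then have "sigma0 X (1 + 1) (\<Union>n::nat. topspace X - S)" by (intro sigma0.intros) auto
    then show ?thesis using two by simp
  next
    case more
    then have "sigma0 X b (\<Union>n::nat. topspace X - S)"
      using assms by (intro sigma0.intros) auto
    then show ?thesis by simp
  qed (use \<open>1 \<le> a\<close> \<open>a < b\<close> in order)
qed

lemma UN_prod_decode: "(\<Union>n. \<Union>m. f n m) = (\<Union>k. f (fst (prod_decode k)) (snd (prod_decode k)))"
proof -
  have "x \<in> (\<Union>k. f (fst (prod_decode k)) (snd (prod_decode k)))" if "x \<in> f n m" for x n m
    using that by (intro UN_I[of "prod_encode (n, m)"]) simp_all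
  then show ?thesis by blast
qed

lemma sigma0_less_mono:
  assumes "sigma0 X a S" "a < b"
  shows "sigma0 X b S"
proof (cases "1 + 1 < b")
  case False
  have "1 \<le> a" using sigma0_ge_1 assms by blast
  with assms False have "a = 1" "b = 1 + 1"
    using omega1_less_add_one_iff[of a 1] omega1_add_one_le_iff[of 1 b] by (auto simp: not_less)
  then have "openin X S" using assms sigma0_1_iff by blast
  then have "sigma0 X (1 + 1) (\<Union>n::nat. S - {})" by (intro sigma0.intros) auto
  then show ?thesis using \<open>b = 1 + 1\<close> by simp
next
  case True
  have "1 \<le> a" using sigma0_ge_1 assms by blast
  then show ?thesis
  proof (cases rule: omega1_level_cases)
    case one
    then have "sigma0 X (1 + 1) (topspace X - S)"
      using assms omega1_less_add_one by (intro sigma0_compl[of X a]) auto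
    then have "sigma0 X b (topspace X - (topspace X - S))" using True by (rule sigma0_compl)
    moreover have "topspace X - (topspace X - S) = S" using sigma0_subset assms by blast
    ultimately show ?thesis by simp
  next
    case two
    from assms(1)[unfolded two] obtain U V where
      UV: "\<And>n::nat. openin X (U n)" "\<And>n. openin X (V n)" "S = (\<Union>n. U n - V n)"
      by (rule sigma0_2E) (rule that)
    have "sigma0 X (1 + 1) (topspace X - (U n - V n))" for n
    proof -
      have sub: "U n \<subseteq> topspace X" "V n \<subseteq> topspace X" using UV openin_subset by blast+
      have "sigma0 X (1 + 1)
        (\<Union>i::nat. (if i = 0 then topspace X else V n) - (if i = 0 then U n else {}))"
        using UV by (intro sigma0.intros) auto
      moreover have "(\<Union>i::nat. (if i = 0 then topspace X else V n) - (if i = 0 then U n else {}))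
          = topspace X - (U n - V n)"
        using sub by (auto split: if_splits intro: exI[of _ 0] exI[of _ 1])
      ultimately show ?thesis by simp
    qed
    then have "sigma0 X b (\<Union>n. topspace X - (topspace X - (U n - V n)))"
      using True by (intro sigma0.intros) auto
    moreover have "(\<Union>n. topspace X - (topspace X - (U n - V n))) = S"
      using UV(1)[THEN openin_subset] UV(3) by blast
    ultimately show ?thesis by simp
  next
    case more
    from assms(1) more obtain B where
      B: "\<And>n::nat. \<exists>c<a. sigma0 X c (B n)" "S = (\<Union>n. topspace X - B n)"
      by (rule sigma0_gt_2E) (rule that)
    have "sigma0 X b (\<Union>n. topspace X - B n)"
      using B(1) assms(2) order.strict_trans by (intro sigma0.intros(3)[OF True]) blast
    then show ?thesis by (simp only: B(2))
  qed
qed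

lemma sigma0_UN:
  assumes "\<And>n::nat. sigma0 X a (S n)"
  shows "sigma0 X a (\<Union>n. S n)"
proof -
  have "1 \<le> a" using sigma0_ge_1 assms by blast
  then show ?thesis
  proof (cases rule: omega1_level_cases)
    case one
    then show ?thesis using assms by (auto simp: sigma0_1_iff)
  next
    case two
    then have "\<forall>n. \<exists>U V. (\<forall>m::nat. openin X (U m) \<and> openin X (V m)) \<and> S n = (\<Union>m. U m - V m)"
      using assms by (simp only: sigma0_2_iff simp_thms)
    then obtain U V where "\<forall>n. (\<forall>m::nat. openin X (U n m) \<and> openin X (V n m))
        \<and> S n = (\<Union>m. U n m - V n m)"
      unfolding choice_iff by (elim exE)
    then have UV: "\<And>n m. openin X (U n m)" "\<And>n m. openin X (V n m)"
        "\<And>n. S n = (\<Union>m::nat. U n m - V n m)" by simp_all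
    have "(\<Union>n. S n) = (\<Union>k. U (fst (prod_decode k)) (snd (prod_decode k))
                             - V (fst (prod_decode k)) (snd (prod_decode k)))"
      unfolding UV(3) by (rule UN_prod_decode)
    also have "sigma0 X a \<dots>" unfolding two by (rule sigma0.intros(2)) (rule UV(1,2))+
    finally show ?thesis .
  next
    case more
    then have "\<forall>n. \<exists>B. (\<forall>m::nat. \<exists>b<a. sigma0 X b (B m)) \<and> S n = (\<Union>m. topspace X - B m)"
      using assms by (simp only: sigma0_gt_2_iff[OF more] simp_thms)
    then obtain B where "\<forall>n. (\<forall>m::nat. \<exists>b<a. sigma0 X b (B n m))
        \<and> S n = (\<Union>m. topspace X - B n m)"
      unfolding choice_iff by (elim exE)
    then have B: "\<And>n m. \<exists>b<a. sigma0 X b (B n m)"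
        "\<And>n. S n = (\<Union>m::nat. topspace X - B n m)" by simp_all
    have "(\<Union>n. S n) = (\<Union>k. topspace X - B (fst (prod_decode k)) (snd (prod_decode k)))"
      unfolding B(2) by (rule UN_prod_decode)
    also have "sigma0 X a \<dots>" by (rule sigma0.intros(3)[OF more]) (rule B(1))
    finally show ?thesis .
  qed
qed

lemma sigma0_Un: "sigma0 X a (S \<union> S')" if "sigma0 X a S" "sigma0 X a S'"
proof -
  have "S \<union> S' = (\<Union>n::nat. if n = 0 then S else S')" by (auto split: if_splits)
  also have "sigma0 X a \<dots>" using that by (intro sigma0_UN) auto
  finally show ?thesis .
qed

lemma sigma0_le_mono: "sigma0 X b S" if "sigma0 X a S" "a \<le> b"
  using that sigma0_less_mono by (metis order.order_iff_strict)

lemma sigma0_Int: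
  assumes "sigma0 X a S" "sigma0 X a S'"
  shows "sigma0 X a (S \<inter> S')"
proof -
  have "1 \<le> a" using sigma0_ge_1 assms by blast
  then show ?thesis
  proof (cases rule: omega1_level_cases)
    case one
    then show ?thesis using assms sigma0_1_iff by blast
  next
    case two
    from assms(1)[unfolded two] obtain U V where
      UV: "\<And>n::nat. openin X (U n)" "\<And>n. openin X (V n)" "S = (\<Union>n. U n - V n)"
      by (rule sigma0_2E) (rule that)
    from assms(2)[unfolded two] obtain U' V' where
      UV': "\<And>n::nat. openin X (U' n)" "\<And>n. openin X (V' n)" "S' = (\<Union>n. U' n - V' n)"
      by (rule sigma0_2E) (rule that)
    have "S \<inter> S' = (\<Union>n m. U n \<inter> U' m - (V n \<union> V' m))" unfolding UV(3) UV'(3) by auto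
    also have "sigma0 X a \<dots>"
    proof (rule sigma0_UN)
      show "sigma0 X a (\<Union>m. U n \<inter> U' m - (V n \<union> V' m))" for n
        unfolding two by (rule sigma0.intros(2)) (use UV UV' in auto)
    qed
    finally show ?thesis .
  next
    case more
    from assms(1) more obtain B where
      B: "\<And>n::nat. \<exists>b<a. sigma0 X b (B n)" "S = (\<Union>n. topspace X - B n)"
      by (rule sigma0_gt_2E) (rule that)
    from assms(2) more obtain B' where
      B': "\<And>n::nat. \<exists>b<a. sigma0 X b (B' n)" "S' = (\<Union>n. topspace X - B' n)"
      by (rule sigma0_gt_2E) (rule that)
    have "S \<inter> S' = (\<Union>n m. topspace X - (B n \<union> B' m))" unfolding B(2) B'(2) by auto
    also have "sigma0 X a \<dots>"
    proof (rule sigma0_UN, rule sigma0.intros(3)[OF more])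
      fix n m
      obtain b b' where b: "b < a" "sigma0 X b (B n)" "b' < a" "sigma0 X b' (B' m)"
        using B(1)[of n] B'(1)[of m] by blast
      have "sigma0 X (max b b') (B n \<union> B' m)"
        by (rule sigma0_Un[OF sigma0_le_mono[OF b(2)] sigma0_le_mono[OF b(4)]]) simp_all
      moreover have "max b b' < a" using b by simp
      ultimately show "\<exists>b<a. sigma0 X b (B n \<union> B' m)" by blast
    qed
    finally show ?thesis .
  qed
qed

lemma base_on_borel: "base_on (topspace X) (borel_base X)"
proof -
  have 1: "1 \<le> 1 + a" for a :: omega1 using omega1_add_rec_props by blast
  have "sigma0 X 1 {}" "sigma0 X 1 (topspace X)" by (simp_all add: sigma0_1_iff)
  then have "sigma0 X (1 + a) {}" "sigma0 X (1 + a) (topspace X)" for a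
    using sigma0_le_mono 1 by blast+
  moreover have "sigma0 X (1 + b) S \<and> sigma0 X (1 + b) (topspace X - S)"
    if "a < b" "sigma0 X (1 + a) S" for a b S
    using sigma0_less_mono[OF that(2)] sigma0_compl[OF that(2)] ord_add_less_mono[OF that(1)]
    by simp
  ultimately show ?thesis
    unfolding borel_base_def by (intro base_onI) (simp_all add: sigma0_subset sigma0_UN sigma0_Int)
qed

section \<open>Functions realised by a term\<close>

text \<open>The function \<open>A\<close> is total on the type and is cut down to the set \<open>Y\<close>, so that the same
  \<open>A\<close> can serve for all components of a family.\<close>

definition realises :: "'q trm \<Rightarrow> 'x set \<Rightarrow> 'x base \<Rightarrow> ('x \<Rightarrow> 'q) \<Rightarrow> bool" where
  "realises u Y L A \<longleftrightarrow> (\<exists>F. is_family u Y L F \<and> determines u Y L F (restrict A Y))"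

lemma determined_iff_realises:
  "A \<in> determined X u \<longleftrightarrow> A \<in> topspace X \<rightarrow>\<^sub>E UNIV \<and> realises u (topspace X) (borel_base X) A"
  unfolding determined_def realises_def by (auto simp: PiE_restrict)

lemma determines_any_base: "determines u Y L F A \<Longrightarrow> determines u Y L' F A"
  by (induction arbitrary: L' rule: determines.induct) (auto intro: determines.intros)

lemma is_family_base_mono: "is_family u Y L F \<Longrightarrow> (\<And>a. L a \<subseteq> L' a) \<Longrightarrow> is_family u Y L' F"
proof (induction arbitrary: L' rule: is_family.induct)
  case (3 u U L X F)
  show ?case
  proof (rule is_family.intros(3))
    show "\<forall>t\<in>nodes u. U t \<in> L' 0" using 3(3,7) by blast
    show "is_family (label u t) (component (nodes u) U t)
            (restrict_base (component (nodes u) U t) L') (F t)" if "t \<in> nodes u" for t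
      using 3(7) by (intro 3(6)[OF that]) (auto simp: restrict_base_def)
  qed (use 3 in simp_all)
qed (auto intro!: is_family.intros simp: shift_def)

lemma realises_base_mono: "realises u Y L' A" if "realises u Y L A" "\<And>a. L a \<subseteq> L' a"
  using that is_family_base_mono determines_any_base unfolding realises_def by meson

inductive_cases determines_ConstE: "determines (Const q) Y L F A"
inductive_cases is_family_ShE: "is_family (Sh a u) Y L F"
inductive_cases determines_ShE: "determines (Sh a u) Y L F A"

lemma not_branching [simp]: "\<not> branching (Const q)" "\<not> branching (Sh a u)"
  and branching [simp]: "branching (FQ q us)" "branching (FO a us)"
  by (simp_all add: branching_def)

lemma realises_Const_iff: "realises (Const q) Y L A \<longleftrightarrow> (\<forall>x\<in>Y. A x = q)"
proof
  assume "realises (Const q) Y L A"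
  then have "restrict A Y = (\<lambda>x\<in>Y. q)"
    unfolding realises_def by (auto elim: determines_ConstE)
  then show "\<forall>x\<in>Y. A x = q" by (metis restrict_apply')
next
  assume "\<forall>x\<in>Y. A x = q"
  then have "restrict A Y = (\<lambda>x\<in>Y. q)" by (simp cong: restrict_cong)
  then show "realises (Const q) Y L A"
    unfolding realises_def by (metis is_family.intros(1) determines.intros(1))
qed

lemma realises_Sh_iff: "realises (Sh a u) Y L A \<longleftrightarrow> realises u Y (shift (omega_pow a) L) A"
  unfolding realises_def
  by (auto elim!: is_family_ShE determines_ShE intro: is_family.intros determines.intros
      dest: determines_any_base)

lemma Nil_in_nodes [simp]: "[] \<in> nodes u"
  by (cases u) auto

lemma not_branching_nodes: "nodes u = {[]}" "label u t = u" if "\<not> branching u"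
  using that by (cases u; simp)+

lemma component_subset: "component T U t \<subseteq> U t"
  by (auto simp: component_def)

text \<open>The condition on families for branching terms, stated for arbitrary terms. For a term that is not branching
  the tree is a single node labelled by the term itself, and nothing is added; this uniformity
  allows families of subterms to be grafted without distinguishing their shape.\<close>

definition realising_tree ::
  "'q trm \<Rightarrow> 'x set \<Rightarrow> 'x base \<Rightarrow> ('x \<Rightarrow> 'q) \<Rightarrow> (nat list \<Rightarrow> 'x set) \<Rightarrow> bool" where
  "realising_tree u Y L A U \<longleftrightarrow>
     monotone_family (nodes u) U \<and> (\<forall>t\<in>nodes u. U t \<in> L 0) \<and> U [] = Y \<and>
     (\<forall>t\<in>nodes u. realises (label u t) (component (nodes u) U t)
        (restrict_base (component (nodes u) U t) L) A)"

lemma monotone_family_subset_root: "U t \<subseteq> U []" if "monotone_family (nodes u) U" "t \<in> nodes u"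
  using that unfolding monotone_family_def by (meson Nil_in_nodes Nil_prefix)

lemma realises_iff_tree:
  assumes "base_on Y L"
  shows "realises u Y L A \<longleftrightarrow> (\<exists>U. realising_tree u Y L A U)"
proof (cases "branching u")
  case False
  have comp: "component {[]} U [] = U []" for U :: "nat list \<Rightarrow> 'a set"
    by (auto simp: component_def)
  have *: "realising_tree u Y L A U \<longleftrightarrow> U [] = Y \<and> realises u Y L A" for U
    using not_branching_nodes[OF False] restrict_self[OF assms] base_onD(3)[OF assms]
    by (auto simp: realising_tree_def monotone_family_def comp)
  show ?thesis unfolding * by (auto intro: exI[of _ "\<lambda>_. Y"])
next
  case True
  show ?thesis
  proof
    assume "realises u Y L A"
    then obtain F where F: "is_family u Y L F" "determines u Y L F (restrict A Y)"
      unfolding realises_def by blast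
    from F(1) True obtain U G where UG: "F = Node U G" "monotone_family (nodes u) U"
      "\<forall>t\<in>nodes u. U t \<in> L 0" "U [] = Y"
      "\<And>t. t \<in> nodes u \<Longrightarrow> is_family (label u t) (component (nodes u) U t)
        (restrict_base (component (nodes u) U t) L) (G t)"
      by cases auto
    from F(2) True UG(1) have D:
      "\<And>t. t \<in> nodes u \<Longrightarrow> determines (label u t) (component (nodes u) U t)
        (restrict_base (component (nodes u) U t) L) (G t)
        (restrict (restrict A Y) (component (nodes u) U t))"
      by cases auto
    have "realises (label u t) (component (nodes u) U t)
        (restrict_base (component (nodes u) U t) L) A" if t: "t \<in> nodes u" for t
    proof -
      have "component (nodes u) U t \<subseteq> Y"
        using component_subset monotone_family_subset_root[OF UG(2) t] UG(4) by fast
      then have "restrict (restrict A Y) (component (nodes u) U t)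
          = restrict A (component (nodes u) U t)"
        by (simp add: restrict_restrict Int_absorb1)
      from D[OF t, unfolded this] UG(5)[OF t] show ?thesis unfolding realises_def by blast
    qed
    then have "realising_tree u Y L A U"
      unfolding realising_tree_def using UG by simp
    then show "\<exists>U. realising_tree u Y L A U" by blast
  next
    assume "\<exists>U. realising_tree u Y L A U"
    then obtain U where U: "realising_tree u Y L A U" by blast
    then obtain G where G: "\<And>t. t \<in> nodes u \<Longrightarrow> is_family (label u t) (component (nodes u) U t)
        (restrict_base (component (nodes u) U t) L) (G t)"
      "\<And>t. t \<in> nodes u \<Longrightarrow> determines (label u t) (component (nodes u) U t)
        (restrict_base (component (nodes u) U t) L) (G t) (restrict A (component (nodes u) U t))"
      unfolding realising_tree_def realises_def by metis
    have "determines u Y L (Node U G) (restrict A Y)"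
    proof (rule determines.intros(3)[OF True])
      fix t assume t: "t \<in> nodes u"
      have "component (nodes u) U t \<subseteq> Y"
        using component_subset monotone_family_subset_root[OF _ t] U
        unfolding realising_tree_def by fast
      then have "restrict (restrict A Y) (component (nodes u) U t)
          = restrict A (component (nodes u) U t)"
        by (simp add: restrict_restrict Int_absorb1)
      then show "determines (label u t) (component (nodes u) U t)
        (restrict_base (component (nodes u) U t) L) (G t)
        (restrict (restrict A Y) (component (nodes u) U t))"
        using G(2)[OF t] by (simp only:)
    qed
    moreover have "is_family u Y L (Node U G)"
      by (rule is_family.intros(3)[OF True]) (use U G(1) in \<open>simp_all add: realising_tree_def\<close>)
    ultimately show "realises u Y L A" unfolding realises_def by blast
  qed
qed

text \<open>A recursive form of the condition on families for branching terms: a family for a branching term amounts to level \<open>0\<close> sets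
  \<open>V\<^sub>i\<close>, the members at the sons of the root, with a family for the \<open>i\<close>-th subterm in each
  \<open>V\<^sub>i\<close>, and a family for the label of the root in what is left. The sets in the families for
  the subterms are relatively of level \<open>0\<close>, hence of level \<open>0\<close> since \<open>V\<^sub>i\<close> is, and components
  are computed within each subtree. The two branching symbols differ only in \<open>c\<close> and \<open>r\<close>.\<close>

lemma realises_branching_iff:
  fixes c :: "nat \<Rightarrow> 'q trm"
  assumes base: "base_on Y L"
    and nodes: "nodes u = insert [] (\<Union>i. (#) i ` nodes (c i))"
    and label: "label u [] = r" "\<And>i t. label u (i # t) = label (c i) t"
  shows "realises u Y L A \<longleftrightarrow>
    (\<exists>V. (\<forall>i. V i \<in> L 0 \<and> realises (c i) (V i) (restrict_base (V i) L) A) \<and>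
         realises r (Y - (\<Union>i. V i)) (restrict_base (Y - (\<Union>i. V i)) L) A)"
proof -
  have Cons_nodes: "i # t \<in> nodes u \<longleftrightarrow> t \<in> nodes (c i)" for i t unfolding nodes by auto
  have comp_Cons: "component (nodes u) U (i # t) = component (nodes (c i)) (\<lambda>s. U (i # s)) t"
    for U :: "nat list \<Rightarrow> 'x set" and i t
  proof -
    have "{s \<in> nodes u. strict_prefix (i # t) s} = (#) i ` {s \<in> nodes (c i). strict_prefix t s}"
      unfolding nodes by auto
    then show ?thesis by (simp add: component_def)
  qed
  have comp_Nil: "component (nodes u) U [] = U [] - (\<Union>i. U [i])"
    if "monotone_family (nodes u) U" for U :: "nat list \<Rightarrow> 'x set"
  proof -
    have "U (i # t) \<subseteq> U [i]" if "t \<in> nodes (c i)" for i t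
      using \<open>monotone_family (nodes u) U\<close>[unfolded monotone_family_def, rule_format, of "[i]" "i # t"]
        that by (simp add: Cons_nodes)
    then have "(\<Union>t\<in>nodes (c i). U (i # t)) = U [i]" for i
      using UN_upper[of "[]" "nodes (c i)" "\<lambda>t. U (i # t)"]
      by (intro equalityI UN_least) simp_all
    moreover have "{t \<in> nodes u. strict_prefix [] t} = (\<Union>i. (#) i ` nodes (c i))"
      unfolding nodes by auto
    ultimately show ?thesis by (simp add: component_def)
  qed
  show ?thesis
  proof
    assume "realises u Y L A"
    then obtain U where "realising_tree u Y L A U" using realises_iff_tree[OF base] by blast
    then have mono: "monotone_family (nodes u) U" and L0: "\<And>t. t \<in> nodes u \<Longrightarrow> U t \<in> L 0"
      and root: "U [] = Y"
      and real: "\<And>t. t \<in> nodes u \<Longrightarrow> realises (label u t) (component (nodes u) U t)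
        (restrict_base (component (nodes u) U t) L) A"
      unfolding realising_tree_def by auto
    have "realises (c i) (U [i]) (restrict_base (U [i]) L) A" for i
    proof -
      have Ui: "U [i] \<in> L 0" by (rule L0) (simp add: Cons_nodes)
      have mono_i: "monotone_family (nodes (c i)) (\<lambda>s. U (i # s))"
        using mono unfolding monotone_family_def by (simp add: Cons_nodes)
      have sub: "U (i # t) \<subseteq> U [i]" if "t \<in> nodes (c i)" for t
        using monotone_family_subset_root[OF mono_i that] by simp
      have "realising_tree (c i) (U [i]) (restrict_base (U [i]) L) A (\<lambda>s. U (i # s))"
        unfolding realising_tree_def
      proof (intro conjI ballI mono_i)
        fix t assume t: "t \<in> nodes (c i)"
        show "U (i # t) \<in> restrict_base (U [i]) L 0"
          using sub[OF t] L0[of "i # t"] t unfolding restrict_base_def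
          by (intro image_eqI[of _ _ "U (i # t)"]) (auto simp: Cons_nodes)
        have "component (nodes (c i)) (\<lambda>s. U (i # s)) t \<subseteq> U [i]"
          using component_subset sub[OF t] by fast
        then show "realises (label (c i) t) (component (nodes (c i)) (\<lambda>s. U (i # s)) t)
           (restrict_base (component (nodes (c i)) (\<lambda>s. U (i # s)) t) (restrict_base (U [i]) L)) A"
          using real[of "i # t"] t by (simp add: restrict_base_twice Cons_nodes comp_Cons label)
      qed simp
      then show ?thesis
        using realises_iff_tree base_on_restrict[OF base base_onD(1)[OF base Ui]] by blast
    qed
    then show "\<exists>V. (\<forall>i. V i \<in> L 0 \<and> realises (c i) (V i) (restrict_base (V i) L) A) \<and>
         realises r (Y - (\<Union>i. V i)) (restrict_base (Y - (\<Union>i. V i)) L) A"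
      using real[of "[]"] comp_Nil[OF mono] L0 root
      by (intro exI[of _ "\<lambda>i. U [i]"]) (auto simp: label Cons_nodes)
  next
    assume "\<exists>V. (\<forall>i. V i \<in> L 0 \<and> realises (c i) (V i) (restrict_base (V i) L) A) \<and>
         realises r (Y - (\<Union>i. V i)) (restrict_base (Y - (\<Union>i. V i)) L) A"
    then obtain V where V: "\<And>i. V i \<in> L 0"
      "\<And>i. realises (c i) (V i) (restrict_base (V i) L) A"
      "realises r (Y - (\<Union>i. V i)) (restrict_base (Y - (\<Union>i. V i)) L) A"
      by blast
    note VY = base_onD(1)[OF base V(1)]
    have "\<exists>W. realising_tree (c i) (V i) (restrict_base (V i) L) A W" for i
      using V(2) realises_iff_tree base_on_restrict[OF base VY] by blast
    then obtain W where W: "\<And>i. realising_tree (c i) (V i) (restrict_base (V i) L) A (W i)"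
      by metis
    define U where "U t = (case t of [] \<Rightarrow> Y | i # s \<Rightarrow> W i s)" for t
    have U_simps [simp]: "U [] = Y" "U (i # s) = W i s" for i s by (simp_all add: U_def)
    have W_mono: "monotone_family (nodes (c i)) (W i)" and W_root [simp]: "W i [] = V i" for i
      using W[of i] by (simp_all add: realising_tree_def)
    have W_sub: "W i s \<subseteq> V i" if "s \<in> nodes (c i)" for i s
      using monotone_family_subset_root[OF W_mono that] by simp
    have mono: "monotone_family (nodes u) U"
      unfolding monotone_family_def
    proof (intro ballI impI)
      fix s t assume st: "s \<in> nodes u" "t \<in> nodes u" "prefix s t"
      show "U t \<subseteq> U s"
      proof (cases s)
        case Nil
        have "W i r \<subseteq> Y" if "r \<in> nodes (c i)" for i r
          using W_sub[OF that] VY[of i] by blast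
        with Nil st show ?thesis by (cases t) (simp_all add: Cons_nodes)
      next
        case (Cons i s')
        then show ?thesis using st W_mono[of i]
          by (cases t) (auto simp: Cons_nodes monotone_family_def)
      qed
    qed
    have "realising_tree u Y L A U"
      unfolding realising_tree_def
    proof (intro conjI ballI mono)
      fix t assume t: "t \<in> nodes u"
      show "U t \<in> L 0"
      proof (cases t)
        case (Cons i s)
        then have "W i s \<in> restrict_base (V i) L 0"
          using t W[of i] by (simp add: realising_tree_def Cons_nodes)
        then show ?thesis using base_of_restrict[OF base V(1)] Cons by simp
      qed (use base_onD(3)[OF base] in simp)
      show "realises (label u t) (component (nodes u) U t)
         (restrict_base (component (nodes u) U t) L) A"
      proof (cases t)
        case Nil
        then show ?thesis using V(3) by (simp add: label comp_Nil[OF mono])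
      next
        case (Cons i s)
        have "component (nodes (c i)) (W i) s \<subseteq> V i"
          using component_subset W_sub t Cons by (fastforce simp: Cons_nodes)
        moreover have "realises (label (c i) s) (component (nodes (c i)) (W i) s)
            (restrict_base (component (nodes (c i)) (W i) s) (restrict_base (V i) L)) A"
          using W[of i] t Cons unfolding realising_tree_def by (auto simp: Cons_nodes)
        ultimately show ?thesis
          unfolding Cons label comp_Cons by (simp add: restrict_base_twice)
      qed
    qed simp
    then show "realises u Y L A" using realises_iff_tree[OF base] by blast
  qed
qed

lemma realises_FQ_iff:
  assumes "base_on Y L"
  shows "realises (FQ q us) Y L A \<longleftrightarrow>
    (\<exists>V. (\<forall>i. V i \<in> L 0 \<and> realises (us i) (V i) (restrict_base (V i) L) A) \<and>
         (\<forall>x\<in>Y - (\<Union>i. V i). A x = q))"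
  by (subst realises_branching_iff[OF assms, where c = us and r = "Const q"])
    (simp_all add: realises_Const_iff)

lemma realises_FO_iff:
  assumes "base_on Y L"
  shows "realises (FO a us) Y L A \<longleftrightarrow>
    (\<exists>V. (\<forall>i. V i \<in> L 0 \<and> realises (us (Suc i)) (V i) (restrict_base (V i) L) A) \<and>
         realises (Sh a (us 0)) (Y - (\<Union>i. V i)) (restrict_base (Y - (\<Union>i. V i)) L) A)"
  by (subst realises_branching_iff[OF assms, where c = "\<lambda>i. us (Suc i)" and r = "Sh a (us 0)"])
    simp_all

section \<open>Partitions realised by terms have the expected Borel level\<close>

lemma realises_countable_range:
  "base_on Y L \<Longrightarrow> realises u Y L A \<Longrightarrow> countable (A ` Y)"
proof (induction u arbitrary: Y L)
  case (Const q)
  then have "A ` Y \<subseteq> {q}" by (auto simp: realises_Const_iff)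
  then show ?case by (meson countable_finite finite.emptyI finite.insertI finite_subset)
next
  case (Sh a u)
  show ?case
    by (rule Sh.IH[OF base_on_shift[OF Sh.prems(1)] Sh.prems(2)[unfolded realises_Sh_iff]])
next
  case (FQ q us)
  then obtain V where V: "\<And>i. V i \<in> L 0"
    "\<And>i. realises (us i) (V i) (restrict_base (V i) L) A" "\<forall>x\<in>Y - (\<Union>i. V i). A x = q"
    unfolding realises_FQ_iff[OF FQ.prems(1)] by blast
  have "countable (A ` V i)" for i
    using FQ.IH[OF _ base_on_restrict[OF FQ.prems(1) base_onD(1)[OF FQ.prems(1) V(1)]] V(2)]
    by blast
  then have "countable (insert q (\<Union>i. A ` V i))" by simp
  moreover have "A ` Y \<subseteq> insert q (\<Union>i. A ` V i)" using V(3) by blast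
  ultimately show ?case using countable_subset by blast
next
  case (FO a us)
  then obtain V where V: "\<And>i. V i \<in> L 0"
    "\<And>i. realises (us (Suc i)) (V i) (restrict_base (V i) L) A"
    "realises (Sh a (us 0)) (Y - (\<Union>i. V i)) (restrict_base (Y - (\<Union>i. V i)) L) A"
    unfolding realises_FO_iff[OF FO.prems(1)] by blast
  have "countable (A ` V i)" for i
    using FO.IH[OF _ base_on_restrict[OF FO.prems(1) base_onD(1)[OF FO.prems(1) V(1)]] V(2)]
    by blast
  moreover have "countable (A ` (Y - (\<Union>i. V i)))"
    using FO.IH[OF _ base_on_shift[OF base_on_restrict[OF FO.prems(1) Diff_subset]]
        V(3)[unfolded realises_Sh_iff]]
    by blast
  ultimately have "countable (A ` (Y - (\<Union>i. V i)) \<union> (\<Union>i. A ` V i))" by simp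
  moreover have "A ` Y \<subseteq> A ` (Y - (\<Union>i. V i)) \<union> (\<Union>i. A ` V i)" by blast
  ultimately show ?case using countable_subset by blast
qed

definition preimages_in :: "'x set set \<Rightarrow> 'x set \<Rightarrow> ('x \<Rightarrow> 'q) \<Rightarrow> bool" where
  "preimages_in \<L> Y A \<longleftrightarrow> (\<forall>Z. {x \<in> Y. A x \<in> Z} \<in> \<L>)"

text \<open>The sets \<open>V\<^sub>i\<close> have level \<open>0\<close> and the rest \<open>Y - \<Union>V\<^sub>i\<close> is the complement of a set of
  level \<open>0\<close>. So both have level \<open>a\<close> as soon as \<open>a > 0\<close>.\<close>

lemma preimages_in_glue:
  assumes base: "base_on Y L" and "0 < a" and V: "\<And>i::nat. V i \<in> L 0"
    and pV: "\<And>i. preimages_in (restrict_base (V i) L a) (V i) A"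
    and pR: "preimages_in (restrict_base (Y - (\<Union>i. V i)) L a) (Y - (\<Union>i. V i)) A"
  shows "preimages_in (L a) Y A"
  unfolding preimages_in_def
proof
  fix Z
  let ?R = "Y - (\<Union>i. V i)"
  have Va: "V i \<in> L a" for i using base_onD(6)[OF base _ V] by simp
  have "{x \<in> V i. A x \<in> Z} \<in> L a" for i
    using pV[of i] base_of_restrict[OF base Va] unfolding preimages_in_def by blast
  then have "(\<Union>i. {x \<in> V i. A x \<in> Z}) \<in> L a" by (rule base_onD(4)[OF base])
  moreover have "?R \<in> L a"
    using base_onD(7)[OF base \<open>0 < a\<close> base_onD(4)[OF base V]] .
  then have "{x \<in> ?R. A x \<in> Z} \<in> L a"
    using pR base_of_restrict[OF base] unfolding preimages_in_def by blast
  ultimately have "(\<Union>i. {x \<in> V i. A x \<in> Z}) \<union> {x \<in> ?R. A x \<in> Z} \<in> L a"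
    by (rule base_on_Un[OF base])
  moreover have "(\<Union>i. {x \<in> V i. A x \<in> Z}) \<union> {x \<in> ?R. A x \<in> Z} = {x \<in> Y. A x \<in> Z}"
    using base_onD(1)[OF base V] by auto
  ultimately show "{x \<in> Y. A x \<in> Z} \<in> L a" by (simp only:)
qed

text \<open>The bound is required in all bases on the given type of points, since the symbols \<open>s\<close> shift
  the base and branching restricts it. The first argument names that type, which occurs only
  under the quantifier.\<close>

definition has_level :: "'x itself \<Rightarrow> omega1 \<Rightarrow> 'q trm \<Rightarrow> bool" where
  "has_level _ a u \<longleftrightarrow>
     (\<forall>(Y :: 'x set) L A. base_on Y L \<longrightarrow> realises u Y L A \<longrightarrow> preimages_in (L a) Y A)"

lemma has_levelD:
  "has_level TYPE('x) a u \<Longrightarrow> base_on Y L \<Longrightarrow> realises u Y L A \<Longrightarrow> preimages_in (L a) (Y :: 'x set) A"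
  by (simp add: has_level_def)

lemma has_level_Const: "has_level TYPE('x) a (Const q)"
  unfolding has_level_def preimages_in_def realises_Const_iff
proof (intro allI impI)
  fix Y :: "'x set" and L A Z
  assume "base_on Y L" "\<forall>x\<in>Y. A x = q"
  moreover then have "{x \<in> Y. A x \<in> Z} = (if q \<in> Z then Y else {})" by auto
  ultimately show "{x \<in> Y. A x \<in> Z} \<in> L a" using base_onD(2,3) by auto
qed

lemma has_level_Sh: "has_level TYPE('x) (omega_pow d + a) (Sh d u)" if "has_level TYPE('x) a u"
  using that base_on_shift unfolding has_level_def realises_Sh_iff by (fastforce simp: shift_def)

lemma has_level_FQ:
  assumes "0 < a" "\<And>i. has_level TYPE('x) a (us i)"
  shows "has_level TYPE('x) a (FQ q us)"
  unfolding has_level_def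
proof (intro allI impI)
  fix Y :: "'x set" and L A
  assume base: "base_on Y L" and "realises (FQ q us) Y L A"
  then obtain V where V: "\<And>i. V i \<in> L 0"
    "\<And>i. realises (us i) (V i) (restrict_base (V i) L) A" "\<forall>x\<in>Y - (\<Union>i. V i). A x = q"
    unfolding realises_FQ_iff[OF base] by blast
  show "preimages_in (L a) Y A"
  proof (rule preimages_in_glue[OF base assms(1) V(1)])
    show "preimages_in (restrict_base (V i) L a) (V i) A" for i
      using has_levelD[OF assms(2) base_on_restrict[OF base base_onD(1)[OF base V(1)]] V(2)] .
    show "preimages_in (restrict_base (Y - (\<Union>i. V i)) L a) (Y - (\<Union>i. V i)) A"
      by (rule has_levelD[OF has_level_Const[of _ q] base_on_restrict[OF base Diff_subset]])
        (unfold realises_Const_iff, rule V(3))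
  qed
qed

lemma has_level_FO:
  assumes "0 < a" "has_level TYPE('x) a (Sh d (us 0))" "\<And>i. has_level TYPE('x) a (us (Suc i))"
  shows "has_level TYPE('x) a (FO d us)"
  unfolding has_level_def
proof (intro allI impI)
  fix Y :: "'x set" and L A
  assume base: "base_on Y L" and "realises (FO d us) Y L A"
  then obtain V where V: "\<And>i. V i \<in> L 0"
    "\<And>i. realises (us (Suc i)) (V i) (restrict_base (V i) L) A"
    "realises (Sh d (us 0)) (Y - (\<Union>i. V i)) (restrict_base (Y - (\<Union>i. V i)) L) A"
    unfolding realises_FO_iff[OF base] by blast
  show "preimages_in (L a) Y A"
  proof (rule preimages_in_glue[OF base assms(1) V(1)])
    show "preimages_in (restrict_base (V i) L a) (V i) A" for i
      using has_levelD[OF assms(3) base_on_restrict[OF base base_onD(1)[OF base V(1)]] V(2)] .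
    show "preimages_in (restrict_base (Y - (\<Union>i. V i)) L a) (Y - (\<Union>i. V i)) A"
      using has_levelD[OF assms(2) base_on_restrict[OF base Diff_subset] V(3)] .
  qed
qed

lemma omega_pow_pos: "0 < omega_pow e"
  using omega_pow_rec_props[of e] by (simp add: omega1_one_le_iff)

lemma omega_pow_add_pos: "0 < omega_pow e + a"
  using omega_pow_pos[of e] omega1_add_rec_props[of "omega_pow e" a] by (meson order.strict_trans2)

lemma omega_pow_absorb_add: "omega_pow d + (omega_pow e + a) = omega_pow e + a" if "d < e"
  using omega_pow_absorb[OF that] by (simp flip: ord_add_assoc)

lemma has_level_omega_terms:
  assumes "u \<in> omega_terms e UNIV"
  shows "has_level TYPE('x) (omega_pow e) u"
  using assms
proof induction
  case (2 d u)
  show ?case using has_level_Sh[OF 2(3), of d] by (simp add: omega_pow_absorb 2(1))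
next
  case (4 d us)
  have "has_level TYPE('x) (omega_pow e) (Sh d (us 0))"
    using has_level_Sh[OF 4(3), of d 0] by (simp add: omega_pow_absorb 4(1))
  then show ?case using 4(3) by (intro has_level_FO) (simp_all add: omega_pow_pos)
qed (simp_all add: has_level_Const has_level_FQ omega_pow_pos)

text \<open>In the flattened term the constants of \<open>P\<close> occur under \<open>s\<^sub>e\<close>, which accounts for the
  level \<open>\<omega>\<^sup>e + a\<close>. All other shifts are by \<open>\<omega>\<^sup>d\<close> with \<open>d < e\<close> and are absorbed.\<close>

lemma has_level_flatten:
  assumes "w \<in> omega_terms e P" "\<And>p. p \<in> P \<Longrightarrow> has_level TYPE('x) a p"
  shows "has_level TYPE('x) (omega_pow e + a) (flatten e w)"
  using assms(1)
proof induction
  case (1 p)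
  show ?case using has_level_Sh[OF assms(2)[OF 1]] by simp
next
  case (2 d u)
  show ?case using has_level_Sh[OF 2(3), of d] by (simp add: omega_pow_absorb_add 2(1))
next
  case (3 p us)
  show ?case
    using has_level_Sh[OF assms(2)[OF 3(1)], of e] 3(3)
    by (auto intro!: has_level_FO simp: omega_pow_add_pos)
next
  case (4 d us)
  have "has_level TYPE('x) (omega_pow e + a) (Sh d (flatten e (us 0)))"
    using has_level_Sh[OF 4(3), of d 0] by (simp add: omega_pow_absorb_add 4(1))
  then show ?case using 4(3) by (auto intro!: has_level_FO simp: omega_pow_add_pos)
qed

lemma has_level_nf_terms:
  fixes u :: "'q trm"
  shows "u \<in> nf_terms es \<Longrightarrow> es \<noteq> [] \<Longrightarrow> has_level TYPE('x) (sum_pows es) u"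
proof (induction es arbitrary: u rule: nf_terms.induct)
  case (3 e e' es)
  then obtain w where w: "w \<in> omega_terms e (nf_terms (e' # es))" "u = flatten e w" by auto
  have "has_level TYPE('x) (sum_pows (e' # es)) p" if "p \<in> nf_terms (e' # es)" for p :: "'q trm"
    using "3.IH"[OF that] by simp
  from has_level_flatten[OF w(1) this] show ?case by (simp add: w(2))
qed (auto intro: has_level_omega_terms)

section \<open>Closure properties of realisable sets\<close>

lemma realises_foldr_Sh_iff:
  "realises (foldr Sh ds u) Y L A \<longleftrightarrow> realises u Y (shift (sum_pows ds) L) A"
  by (induction ds arbitrary: L) (simp_all add: realises_Sh_iff shift_shift)

lemma foldr_Sh_omega_terms:
  "u \<in> omega_terms g P \<Longrightarrow> set ds \<subseteq> {..<g} \<Longrightarrow> foldr Sh ds u \<in> omega_terms g P"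
  by (induction ds) (auto intro: omega_terms.intros)

text \<open>The base is given on a set containing \<open>Y\<close>.\<close>

definition realisable :: "omega1 \<Rightarrow> 'x base \<Rightarrow> ('x \<Rightarrow> 'q) \<Rightarrow> 'x set \<Rightarrow> bool" where
  "realisable g L A Y \<longleftrightarrow> (\<exists>u\<in>omega_terms g UNIV. realises u Y (restrict_base Y L) A)"

lemma realisable_const: "realisable g L A Y" if "\<forall>x\<in>Y. A x = q"
  unfolding realisable_def using that omega_terms.intros(1)[of q UNIV g]
  by (intro bexI[of _ "Const q"]) (simp_all add: realises_Const_iff)

text \<open>The symbols \<open>s\<^sub>\<delta>\<close> for \<open>\<delta>\<close> in \<open>ds\<close> raise level \<open>0\<close> to the level of the sets \<open>S\<^sub>n\<close>,
  so a single branching after them separates the pieces \<open>Y \<inter> S\<^sub>n\<close>. The terms for the pieces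
  remain usable after the shift, because it makes the base larger.\<close>

lemma realisable_UN:
  fixes S :: "nat \<Rightarrow> 'x set"
  assumes base: "base_on X L" and Y: "Y \<subseteq> X" and ds: "set ds \<subseteq> {..<g}"
    and S: "\<And>n. S n \<in> L (sum_pows ds)" and real: "\<And>n. realisable g L A (Y \<inter> S n)"
  shows "realisable g L A (Y \<inter> (\<Union>n. S n))"
proof -
  let ?L = "shift (sum_pows ds) L" and ?Z = "Y \<inter> (\<Union>n. S n)"
  have base': "base_on ?Z (restrict_base ?Z ?L)"
    using base_on_restrict[OF base_on_shift[OF base]] Y by blast
  obtain u where u: "\<And>n. u n \<in> omega_terms g UNIV"
    "\<And>n. realises (u n) (Y \<inter> S n) (restrict_base (Y \<inter> S n) L) A"
    using real unfolding realisable_def by metis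
  have "L a \<subseteq> ?L a" for a
    using base_onD(6)[OF base ord_le_add_left] by (auto simp: shift_def)
  then have "restrict_base (Y \<inter> S n) L a \<subseteq> restrict_base (Y \<inter> S n) ?L a" for n a
    unfolding restrict_base_def by blast
  then have u': "realises (u n) (Y \<inter> S n) (restrict_base (Y \<inter> S n) ?L) A" for n
    using realises_base_mono[OF u(2)] by blast
  have eq: "?Z \<inter> S n = Y \<inter> S n" for n by blast
  have "Y \<inter> S n \<in> restrict_base ?Z ?L 0 \<and>
      realises (u n) (Y \<inter> S n) (restrict_base (Y \<inter> S n) (restrict_base ?Z ?L)) A" for n
  proof
    show "Y \<inter> S n \<in> restrict_base ?Z ?L 0"
      unfolding restrict_base_def using S[of n] eq[of n]
      by (intro image_eqI[of _ _ "S n"]) (simp_all add: shift_def)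
    have "Y \<inter> S n \<subseteq> ?Z" by blast
    then show "realises (u n) (Y \<inter> S n) (restrict_base (Y \<inter> S n) (restrict_base ?Z ?L)) A"
      using u'[of n] by (simp add: restrict_base_twice)
  qed
  moreover have "?Z - (\<Union>n. Y \<inter> S n) = {}" by blast
  \<comment> \<open>The sons cover \<open>?Z\<close>, so the label of the root applies to the empty set.\<close>
  ultimately have "realises (FQ undefined u) ?Z (restrict_base ?Z ?L) A"
    unfolding realises_FQ_iff[OF base'] by (intro exI[of _ "\<lambda>n. Y \<inter> S n"]) simp
  then have "realises (foldr Sh ds (FQ undefined u)) ?Z (restrict_base ?Z L) A"
    by (simp add: realises_foldr_Sh_iff shift_restrict)
  moreover have "foldr Sh ds (FQ undefined u) \<in> omega_terms g UNIV"
    using u(1) ds by (intro foldr_Sh_omega_terms omega_terms.intros) simp_all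
  ultimately show ?thesis unfolding realisable_def by blast
qed

text \<open>For \<open>\<gamma> = 0\<close> there is no shift available that would make \<open>Y - S\<close> a member of a family.
  Instead \<open>S\<close> is added to every member of the family given on \<open>Y - S\<close>, and at each node a
  further son with member \<open>Y \<inter> S\<close> and term \<open>v\<close> is attached. This removes \<open>S\<close> from the
  components of the old nodes, which are thus the same as before.\<close>

lemma realisable_Un_difference:
  assumes base: "base_on X L" and S: "S \<in> L 0"
    and u: "u \<in> omega_terms 0 UNIV" and v: "v \<in> omega_terms 0 UNIV"
  shows "Y \<subseteq> X \<Longrightarrow> realises u (Y - S) (restrict_base (Y - S) L) A \<Longrightarrow>
    realises v (Y \<inter> S) (restrict_base (Y \<inter> S) L) A \<Longrightarrow> realisable 0 L A Y"
  using u
proof (induction arbitrary: Y)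
  case (1 p)
  have base': "base_on Y (restrict_base Y L)" using base_on_restrict[OF base 1(2)] .
  have "Y \<inter> S \<in> restrict_base Y L 0" using S by (auto simp: restrict_base_def)
  moreover have "Y - (\<Union>i::nat. Y \<inter> S) = Y - S" by blast
  ultimately have "realises (FQ p (\<lambda>_. v)) Y (restrict_base Y L) A"
    unfolding realises_FQ_iff[OF base'] using 1
    by (intro exI[of _ "\<lambda>_. Y \<inter> S"]) (simp add: restrict_base_twice realises_Const_iff)
  moreover have "FQ p (\<lambda>_. v) \<in> omega_terms 0 UNIV" using v by (intro omega_terms.intros) simp_all
  ultimately show ?case unfolding realisable_def by blast
next
  case (3 p us)
  have base': "base_on Y (restrict_base Y L)" using base_on_restrict[OF base 3(4)] .
  have "Y - S \<subseteq> X" using 3(4) by blast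
  then have base'': "base_on (Y - S) (restrict_base (Y - S) L)" by (rule base_on_restrict[OF base])
  from 3(5) obtain V where V: "\<And>i. V i \<in> restrict_base (Y - S) L 0"
    "\<And>i. realises (us i) (V i) (restrict_base (V i) (restrict_base (Y - S) L)) A"
    "\<forall>x\<in>Y - S - (\<Union>i. V i). A x = p"
    unfolding realises_FQ_iff[OF base''] by blast
  obtain W where W: "\<And>i. W i \<in> L 0" "\<And>i. V i = (Y - S) \<inter> W i"
    using V(1) unfolding restrict_base_def image_iff by metis
  have "realisable 0 L A (Y \<inter> (W i \<union> S))" for i
  proof (rule 3(3))
    have "V i \<subseteq> Y - S" using W by blast
    then have "realises (us i) (V i) (restrict_base (V i) L) A"
      using V(2)[of i] by (simp add: restrict_base_twice)
    moreover have "Y \<inter> (W i \<union> S) - S = V i" using W by blast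
    ultimately show "realises (us i) (Y \<inter> (W i \<union> S) - S)
        (restrict_base (Y \<inter> (W i \<union> S) - S) L) A" by simp
    have "Y \<inter> (W i \<union> S) \<inter> S = Y \<inter> S" by blast
    then show "realises v (Y \<inter> (W i \<union> S) \<inter> S) (restrict_base (Y \<inter> (W i \<union> S) \<inter> S) L) A"
      using 3(6) by simp
  qed (use 3(4) in blast)
  then obtain u' where u': "\<And>i. u' i \<in> omega_terms 0 UNIV"
    "\<And>i. realises (u' i) (Y \<inter> (W i \<union> S)) (restrict_base (Y \<inter> (W i \<union> S)) L) A"
    unfolding realisable_def by metis
  define U where "U = case_nat (Y \<inter> S) (\<lambda>i. Y \<inter> (W i \<union> S))"
  have "U i \<in> restrict_base Y L 0 \<and>
    realises (case_nat v u' i) (U i) (restrict_base (U i) (restrict_base Y L)) A" for i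
  proof
    show "U i \<in> restrict_base Y L 0"
      unfolding U_def restrict_base_def using S W(1) base_on_Un[OF base]
      by (cases i) auto
    have "U i \<subseteq> Y" unfolding U_def by (cases i) auto
    then show "realises (case_nat v u' i) (U i) (restrict_base (U i) (restrict_base Y L)) A"
      using u'(2) 3(6) unfolding U_def by (cases i) (simp_all add: restrict_base_twice)
  qed
  moreover have "\<forall>x\<in>Y - (\<Union>i. U i). A x = p"
  proof
    fix x assume x: "x \<in> Y - (\<Union>i. U i)"
    then have "x \<notin> U 0" "\<And>i. x \<notin> U (Suc i)" by blast+
    then have "x \<in> Y - S - (\<Union>i. V i)" using x unfolding U_def W(2) by simp
    then show "A x = p" using V(3) by blast
  qed
  ultimately have "realises (FQ p (case_nat v u')) Y (restrict_base Y L) A"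
    unfolding realises_FQ_iff[OF base'] by (intro exI[of _ U]) blast
  moreover have "FQ p (case_nat v u') \<in> omega_terms 0 UNIV"
    using v u'(1) by (intro omega_terms.intros) (simp_all split: nat.split)
  ultimately show ?case unfolding realisable_def by blast
qed simp_all

text \<open>For \<open>\<gamma> > 0\<close> one more shift by \<open>\<omega>\<^sup>0 = 1\<close> is possible and makes both \<open>S\<close> and its
  complement available as members of a family.\<close>

lemma realisable_split:
  assumes base: "base_on X L" and Y: "Y \<subseteq> X" and ds: "set ds \<subseteq> {..<g}"
    and S: "S \<in> L (sum_pows ds)"
    and real: "realisable g L A (Y \<inter> S)" "realisable g L A (Y - S)"
  shows "realisable g L A Y"
proof (cases "g = 0")
  case True
  then have "ds = []" using ds by (cases ds) auto
  with S have "S \<in> L 0" by simp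
  then show ?thesis
    using real Y realisable_Un_difference[OF base] unfolding True realisable_def[of 0 L A "_ \<inter> _"]
      realisable_def[of 0 L A "_ - _"] by blast
next
  case False
  then have "0 < g" using omega1_zero_le[of g] by order
  let ?S = "\<lambda>n::nat. if n = 0 then S else X - S"
  have "sum_pows ds < sum_pows (ds @ [0])"
    by (simp add: sum_pows_append omega1_less_add_one)
  then have "S \<in> L (sum_pows (ds @ [0]))" "X - S \<in> L (sum_pows (ds @ [0]))"
    using base_onD(6,7)[OF base _ S] by (auto simp: less_imp_le)
  then have "realisable g L A (Y \<inter> (\<Union>n. ?S n))"
  proof (intro realisable_UN[OF base Y, of "ds @ [0]"])
    have "Y \<inter> (X - S) = Y - S" using Y by blast
    then show "realisable g L A (Y \<inter> ?S n)" for n using real by simp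
  qed (use ds \<open>0 < g\<close> in simp_all)
  moreover have "Y \<inter> (\<Union>n. ?S n) = Y" using Y by (auto split: if_splits)
  ultimately show ?thesis by simp
qed

section \<open>Quasi-Polish spaces\<close>

text \<open>The basic open sets are closed under finite intersections, so they form a basis and not
  just a subbasis.\<close>

lemma openin_scott_iff:
  "openin scott_powerset T \<longleftrightarrow> (\<exists>\<F>. \<F> \<subseteq> Collect finite \<and> T = {I. \<exists>F\<in>\<F>. F \<subseteq> I})"
proof
  assume "openin scott_powerset T"
  then have "generate_topology_on {{A. F \<subseteq> A} |F. finite F} T"
    unfolding scott_powerset_def by (rule openin_topology_generated_by)
  then have *: "\<forall>I\<in>T. \<exists>F. finite F \<and> F \<subseteq> I \<and> (\<forall>J. F \<subseteq> J \<longrightarrow> J \<in> T)"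
  proof induction
    case (Int a b)
    show ?case
    proof
      fix I assume I: "I \<in> a \<inter> b"
      obtain F where "finite F \<and> F \<subseteq> I \<and> (\<forall>J. F \<subseteq> J \<longrightarrow> J \<in> a)"
        using bspec[OF Int.IH(1) IntD1[OF I]] by (elim exE)
      moreover obtain G where "finite G \<and> G \<subseteq> I \<and> (\<forall>J. G \<subseteq> J \<longrightarrow> J \<in> b)"
        using bspec[OF Int.IH(2) IntD2[OF I]] by (elim exE)
      ultimately show "\<exists>F. finite F \<and> F \<subseteq> I \<and> (\<forall>J. F \<subseteq> J \<longrightarrow> J \<in> a \<inter> b)"
        by (intro exI[of _ "F \<union> G"]) simp
    qed
  next
    case (UN K)
    show ?case
    proof
      fix I assume "I \<in> \<Union>K"
      then obtain c where c: "c \<in> K" "I \<in> c" by blast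
      then obtain F where "finite F \<and> F \<subseteq> I \<and> (\<forall>J. F \<subseteq> J \<longrightarrow> J \<in> c)"
        using bspec[OF UN.IH[OF c(1)] c(2)] by (elim exE)
      then show "\<exists>F. finite F \<and> F \<subseteq> I \<and> (\<forall>J. F \<subseteq> J \<longrightarrow> J \<in> \<Union>K)"
        using c(1) by (intro exI[of _ F]) auto
    qed
  next
    case (Basis s)
    then obtain F where "finite F" "s = {A. F \<subseteq> A}" by blast
    then show ?case by (intro ballI exI[of _ F]) simp
  qed simp
  show "\<exists>\<F>. \<F> \<subseteq> Collect finite \<and> T = {I. \<exists>F\<in>\<F>. F \<subseteq> I}"
    using * by (intro exI[of _ "{F. finite F \<and> (\<forall>J. F \<subseteq> J \<longrightarrow> J \<in> T)}"]) auto
next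
  assume "\<exists>\<F>. \<F> \<subseteq> Collect finite \<and> T = {I. \<exists>F\<in>\<F>. F \<subseteq> I}"
  then obtain \<F> where \<F>: "\<F> \<subseteq> Collect finite" "T = {I. \<exists>F\<in>\<F>. F \<subseteq> I}" by (elim exE conjE)
  have "openin scott_powerset {I. F \<subseteq> I}" if "F \<in> \<F>" for F
    unfolding scott_powerset_def using \<F>(1) that by (intro topology_generated_by_Basis) auto
  then have "openin scott_powerset (\<Union>F\<in>\<F>. {I. F \<subseteq> I})" by blast
  moreover have "T = (\<Union>F\<in>\<F>. {I. F \<subseteq> I})" unfolding \<F>(2) by auto
  ultimately show "openin scott_powerset T" by (simp only:)
qed

text \<open>Via the coordinates \<open>h\<close>, finite sets \<open>F\<close> stand for the basic open sets
  \<open>{x. F \<subseteq> h x}\<close>. A \<open>\<Pi>\<^sup>0\<^sub>2\<close> set is the intersection of countably many implications between open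
  sets, whose premises and conclusions are listed by \<open>\<U> k\<close> and \<open>\<V> k\<close>.\<close>

lemma quasi_polish_presentation:
  assumes "quasi_polish X"
  obtains h :: "'x \<Rightarrow> nat set" and \<U> \<V> :: "nat \<Rightarrow> nat set set" where
    "\<And>S. openin X S \<longleftrightarrow>
       (\<exists>\<F>. \<F> \<subseteq> Collect finite \<and> S = {x \<in> topspace X. \<exists>F\<in>\<F>. F \<subseteq> h x})"
    "\<And>k. \<U> k \<subseteq> Collect finite" "\<And>k. \<V> k \<subseteq> Collect finite"
    "h ` topspace X = {I. \<forall>k. (\<exists>F\<in>\<U> k. F \<subseteq> I) \<longrightarrow> (\<exists>F\<in>\<V> k. F \<subseteq> I)}"
proof -
  obtain S where S: "sigma0 scott_powerset (1 + 1) (UNIV - S)"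
    "X homeomorphic_space subtopology scott_powerset S"
    using assms unfolding quasi_polish_def by blast
  have top: "topspace scott_powerset = UNIV"
  proof -
    have "openin scott_powerset UNIV"
      unfolding openin_scott_iff by (intro exI[of _ "{{}}"]) auto
    then show ?thesis using openin_subset by blast
  qed
  obtain h where h: "homeomorphic_map X (subtopology scott_powerset S) h"
    using S(2) unfolding homeomorphic_space_def homeomorphic_map_maps by blast
  have hS: "h ` topspace X = S"
    using homeomorphic_imp_surjective_map[OF h] top by simp
  have inj: "inj_on h (topspace X)" using homeomorphic_imp_injective_map[OF h] .
  have opens: "openin X R \<longleftrightarrow>
      (\<exists>\<F>. \<F> \<subseteq> Collect finite \<and> R = {x \<in> topspace X. \<exists>F\<in>\<F>. F \<subseteq> h x})" for R
  proof
    assume R: "openin X R"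
    then have sub: "R \<subseteq> topspace X" by (rule openin_subset)
    then have "openin (subtopology scott_powerset S) (h ` R)"
      using homeomorphic_map_openness[OF h] R by blast
    then obtain T where T: "openin scott_powerset T" "h ` R = T \<inter> S"
      unfolding openin_subtopology by blast
    then obtain \<F> where \<F>: "\<F> \<subseteq> Collect finite" "T = {I. \<exists>F\<in>\<F>. F \<subseteq> I}"
      unfolding openin_scott_iff by (elim exE conjE)
    have "x \<in> R \<longleftrightarrow> x \<in> topspace X \<and> h x \<in> T" for x
    proof
      assume "x \<in> topspace X \<and> h x \<in> T"
      then have "h x \<in> h ` R" using T(2) hS by blast
      then show "x \<in> R" using inj sub \<open>x \<in> topspace X \<and> h x \<in> T\<close> by (meson inj_on_image_mem_iff)
    qed (use T(2) sub in blast)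
    then show "\<exists>\<F>. \<F> \<subseteq> Collect finite \<and> R = {x \<in> topspace X. \<exists>F\<in>\<F>. F \<subseteq> h x}"
      using \<F> by (intro exI[of _ \<F>]) auto
  next
    assume "\<exists>\<F>. \<F> \<subseteq> Collect finite \<and> R = {x \<in> topspace X. \<exists>F\<in>\<F>. F \<subseteq> h x}"
    then obtain \<F> where \<F>: "\<F> \<subseteq> Collect finite" "R = {x \<in> topspace X. \<exists>F\<in>\<F>. F \<subseteq> h x}"
      by (elim exE conjE)
    let ?T = "{I. \<exists>F\<in>\<F>. F \<subseteq> I}"
    have "openin scott_powerset ?T" unfolding openin_scott_iff using \<F>(1) by blast
    then have "openin (subtopology scott_powerset S) (?T \<inter> S)"
      by (auto simp: openin_subtopology)
    then have "openin X {x \<in> topspace X. h x \<in> ?T \<inter> S}"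
      using homeomorphic_imp_continuous_map[OF h] openin_continuous_map_preimage by blast
    moreover have "{x \<in> topspace X. h x \<in> ?T \<inter> S} = R" unfolding \<F>(2) using hS by auto
    ultimately show "openin X R" by (simp only:)
  qed
  from S(1) obtain U V where UV: "\<And>n::nat. openin scott_powerset (U n)"
    "\<And>n. openin scott_powerset (V n)" "UNIV - S = (\<Union>n. U n - V n)"
    by (rule sigma0_2E) (rule that)
  have "\<forall>n. \<exists>\<F>. \<F> \<subseteq> Collect finite \<and> U n = {I. \<exists>F\<in>\<F>. F \<subseteq> I}"
    using UV(1) unfolding openin_scott_iff by simp
  then obtain \<U> where \<U>: "\<forall>n. \<U> n \<subseteq> Collect finite \<and> U n = {I. \<exists>F\<in>\<U> n. F \<subseteq> I}"
    unfolding choice_iff by (elim exE)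
  have "\<forall>n. \<exists>\<F>. \<F> \<subseteq> Collect finite \<and> V n = {I. \<exists>F\<in>\<F>. F \<subseteq> I}"
    using UV(2) unfolding openin_scott_iff by simp
  then obtain \<V> where \<V>: "\<forall>n. \<V> n \<subseteq> Collect finite \<and> V n = {I. \<exists>F\<in>\<V> n. F \<subseteq> I}"
    unfolding choice_iff by (elim exE)
  have "S = {I. \<forall>k. I \<in> U k \<longrightarrow> I \<in> V k}" using UV(3) by blast
  also have "\<dots> = {I. \<forall>k. (\<exists>F\<in>\<U> k. F \<subseteq> I) \<longrightarrow> (\<exists>F\<in>\<V> k. F \<subseteq> I)}"
    using \<U> \<V> by simp
  finally show thesis using that[of h \<U> \<V>] opens \<U> \<V> hS by simp
qed

text \<open>The intended property \<open>P\<close> is realisability, and the intended bound is \<open>k = 1 + \<alpha>\<close>.\<close>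

locale split_closed =
  fixes X :: "'x topology" and h :: "'x \<Rightarrow> nat set"
    and k :: omega1 and P :: "'x set \<Rightarrow> bool"
  assumes openin_iff: "openin X S \<longleftrightarrow>
       (\<exists>\<F>. \<F> \<subseteq> Collect finite \<and> S = {x \<in> topspace X. \<exists>F\<in>\<F>. F \<subseteq> h x})"
    and level: "1 < k"
    and empty: "P {}"
    and split: "a < k \<Longrightarrow> sigma0 X a S \<Longrightarrow> Y \<subseteq> topspace X \<Longrightarrow> P (Y \<inter> S) \<Longrightarrow> P (Y - S) \<Longrightarrow> P Y"
    and union: "a < k \<Longrightarrow> (\<And>n::nat. sigma0 X a (R n)) \<Longrightarrow> Y \<subseteq> topspace X \<Longrightarrow>
      (\<And>n. P (Y \<inter> R n)) \<Longrightarrow> P (Y \<inter> (\<Union>n. R n))"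
begin

text \<open>This is applied in the contrapositive: a set without property \<open>P\<close> meets some member of \<open>\<C>\<close> in a set without
  property \<open>P\<close>.\<close>

definition good :: "'x set set \<Rightarrow> bool" where
  "good \<C> \<longleftrightarrow> (\<forall>Y\<subseteq>topspace X. (\<forall>C\<in>\<C>. P (Y \<inter> C)) \<longrightarrow> P Y)"

definition meets :: "'x filter \<Rightarrow> 'x set set set \<Rightarrow> bool" where
  "meets F \<K> \<longleftrightarrow> (\<forall>\<C>\<in>\<K>. \<exists>C\<in>\<C>. eventually (\<lambda>x. x \<in> C) F)"

text \<open>These coverings force a witness: a filter that contains a member of the covering and
  contains \<open>\<Union>\<G>\<close> contains some set of \<open>\<G>\<close>.\<close>

lemma good_cover:
  assumes "a < k" "countable \<G>" "\<And>S. S \<in> \<G> \<Longrightarrow> sigma0 X a S"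
  shows "good (insert (topspace X - \<Union>\<G>) \<G>)"
proof (cases "\<G> = {}")
  case True
  have "Y \<inter> topspace X = Y" if "Y \<subseteq> topspace X" for Y using that by blast
  then show ?thesis using True by (simp add: good_def)
next
  case False
  define R where "R = from_nat_into \<G>"
  have R: "range R = \<G>" using False assms(2) by (simp add: R_def range_from_nat_into)
  then have sig: "sigma0 X a (R n)" for n using assms(3) by blast
  show ?thesis
    unfolding good_def
  proof (intro allI impI)
    fix Y assume Y: "Y \<subseteq> topspace X" and
      all: "\<forall>C\<in>insert (topspace X - \<Union>\<G>) \<G>. P (Y \<inter> C)"
    have "P (Y \<inter> R n)" for n using all R by blast
    then have "P (Y \<inter> (\<Union>n. R n))" by (rule union[OF assms(1) sig Y])
    moreover have "Y \<inter> (topspace X - \<Union>\<G>) = Y - (\<Union>n. R n)" using R Y by blast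
    then have "P (Y - (\<Union>n. R n))" using all by (metis insertI1)
    ultimately show "P Y" by (rule split[OF assms(1) sigma0_UN[OF sig] Y])
  qed
qed

text \<open>Intersect \<open>X\<close> successively with members of the coverings, always keeping a set without
  property \<open>P\<close>. Such sets are nonempty, so their supersets form a proper filter.\<close>

lemma generic_filter:
  assumes "countable \<K>" "\<And>\<C>. \<C> \<in> \<K> \<Longrightarrow> good \<C>" "\<not> P (topspace X)"
  obtains F where "F \<noteq> bot" "eventually (\<lambda>x. x \<in> topspace X) F" "meets F \<K>"
    "\<And>Z. eventually (\<lambda>x. x \<in> Z) F \<Longrightarrow> \<exists>Y. Y \<subseteq> topspace X \<inter> Z \<and> \<not> P Y"
proof -
  \<comment> \<open>The trivial covering is added so that there is something to enumerate.\<close>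
  define c where "c = from_nat_into (insert {topspace X} \<K>)"
  have range_c: "range c = insert {topspace X} \<K>"
    unfolding c_def using assms(1) by (intro range_from_nat_into) auto
  have triv: "Y \<inter> topspace X = Y" if "Y \<subseteq> topspace X" for Y using that by blast
  have good_c: "good (c n)" for n
  proof -
    have "c n \<in> insert {topspace X} \<K>" using range_c by blast
    then show ?thesis using assms(2) triv by (auto simp: good_def)
  qed
  have "\<exists>Y. \<forall>n. (Y n \<subseteq> topspace X \<and> \<not> P (Y n)) \<and> (\<exists>C\<in>c n. Y (Suc n) = Y n \<inter> C)"
  proof (rule dependent_nat_choice)
    show "\<exists>Y. Y \<subseteq> topspace X \<and> \<not> P Y" using assms(3) by blast
    fix Y n assume Y: "Y \<subseteq> topspace X \<and> \<not> P Y"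
    then obtain C where "C \<in> c n" "\<not> P (Y \<inter> C)" using good_c[of n] unfolding good_def by blast
    then show "\<exists>Y'. (Y' \<subseteq> topspace X \<and> \<not> P Y') \<and> (\<exists>C\<in>c n. Y' = Y \<inter> C)"
      using Y by (intro exI[of _ "Y \<inter> C"]) blast
  qed
  then obtain Y where "\<forall>n. (Y n \<subseteq> topspace X \<and> \<not> P (Y n)) \<and> (\<exists>C\<in>c n. Y (Suc n) = Y n \<inter> C)"
    by (elim exE)
  then have Y: "\<And>n. Y n \<subseteq> topspace X" "\<And>n. \<not> P (Y n)"
    "\<And>n. \<exists>C\<in>c n. Y (Suc n) = Y n \<inter> C" by blast+
  have "Y (Suc n) \<subseteq> Y n" for n using Y(3)[of n] by (elim bexE) simp
  then have dec: "Y m \<subseteq> Y n" if "n \<le> m" for m n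
    using that by (rule lift_Suc_antimono_le)
  define F where "F = (INF n. principal (Y n))"
  have ev: "eventually Q F \<longleftrightarrow> (\<exists>n. \<forall>x\<in>Y n. Q x)" for Q
  proof -
    have "\<exists>i\<in>UNIV. principal (Y i) \<le> inf (principal (Y m)) (principal (Y n))" for m n
      using dec[of m "max m n"] dec[of n "max m n"] by (intro bexI[of _ "max m n"]) auto
    then show ?thesis unfolding F_def
      by (subst eventually_INF_base) (auto simp: eventually_principal)
  qed
  show thesis
  proof (rule that)
    show "F \<noteq> bot"
    proof
      assume "F = bot"
      then have "\<exists>n. Y n = {}" using ev[of "\<lambda>_. False"] by auto
      then show False using Y(2) empty by metis
    qed
    show "eventually (\<lambda>x. x \<in> topspace X) F" using ev Y(1) by blast
    show "meets F \<K>"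
      unfolding meets_def
    proof
      fix \<C> assume "\<C> \<in> \<K>"
      then obtain n where "c n = \<C>" using range_c by (metis insertI2 rangeE)
      then obtain C where "C \<in> \<C>" "Y (Suc n) = Y n \<inter> C" using Y(3)[of n] by blast
      moreover then have "eventually (\<lambda>x. x \<in> C) F" unfolding ev by (intro exI[of _ "Suc n"]) simp
      ultimately show "\<exists>C\<in>\<C>. eventually (\<lambda>x. x \<in> C) F" by blast
    qed
    fix Z assume "eventually (\<lambda>x. x \<in> Z) F"
    then obtain n where "\<forall>x\<in>Y n. x \<in> Z" using ev by blast
    then show "\<exists>Y. Y \<subseteq> topspace X \<inter> Z \<and> \<not> P Y" using Y(1,2) by (intro exI[of _ "Y n"]) blast
  qed
qed

text \<open>The filter need not converge to \<open>x\<close> in any finer sense, but it accepts the same basic open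
  sets as \<open>x\<close>.\<close>

definition shadows :: "'x filter \<Rightarrow> 'x \<Rightarrow> bool" where
  "shadows F x \<longleftrightarrow> F \<noteq> bot \<and> eventually (\<lambda>y. y \<in> topspace X) F \<and> x \<in> topspace X \<and>
     (\<forall>n. n \<in> h x \<longleftrightarrow> eventually (\<lambda>y. n \<in> h y) F)"

text \<open>A filter that meets the coverings in \<open>\<K>\<close> decides \<open>S\<close>, and decides it in accordance with
  the point that it shadows.\<close>

definition settles :: "'x set set set \<Rightarrow> 'x set \<Rightarrow> bool" where
  "settles \<K> S \<longleftrightarrow> (\<forall>F x. meets F \<K> \<longrightarrow> shadows F x \<longrightarrow>
     (x \<in> S \<longrightarrow> eventually (\<lambda>y. y \<in> S) F) \<and> (x \<notin> S \<longrightarrow> eventually (\<lambda>y. y \<notin> S) F))"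

definition settled :: "'x set \<Rightarrow> bool" where
  "settled S \<longleftrightarrow> (\<exists>\<K>. countable \<K> \<and> (\<forall>\<C>\<in>\<K>. good \<C>) \<and> settles \<K> S)"

lemma meets_mono: "meets F \<K>" if "meets F \<K>'" "\<K> \<subseteq> \<K>'"
  using that unfolding meets_def by blast

lemma shadows_eventually_not:
  assumes "shadows F x" "eventually (\<lambda>y. y \<in> S) F" "eventually (\<lambda>y. y \<notin> S) F"
  shows False
proof -
  have "eventually (\<lambda>_. False) F" using assms(2,3) by eventually_elim blast
  then show False using assms(1) by (simp add: shadows_def)
qed

lemma shadows_eventually_subset:
  assumes "shadows F x" "finite N"
  shows "N \<subseteq> h x \<longleftrightarrow> eventually (\<lambda>y. N \<subseteq> h y) F"
proof
  assume "N \<subseteq> h x"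
  then have "\<forall>n\<in>N. eventually (\<lambda>y. n \<in> h y) F" using assms(1) unfolding shadows_def by blast
  then have "eventually (\<lambda>y. \<forall>n\<in>N. n \<in> h y) F" by (rule eventually_ball_finite[OF assms(2)])
  then show "eventually (\<lambda>y. N \<subseteq> h y) F" by eventually_elim blast
next
  assume "eventually (\<lambda>y. N \<subseteq> h y) F"
  then have "eventually (\<lambda>y. n \<in> h y) F" if "n \<in> N" for n
    by eventually_elim (use that in blast)
  then show "N \<subseteq> h x" using assms(1) unfolding shadows_def by blast
qed

lemma openin_basic: "openin X {x \<in> topspace X. N \<subseteq> h x}" if "finite N"
  unfolding openin_iff using that by (intro exI[of _ "{N}"]) simp

lemma settled_basic:
  assumes "finite N"
  shows "settled {x \<in> topspace X. N \<subseteq> h x}" (is "settled ?N")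
  unfolding settled_def
proof (intro exI[of _ "{insert (topspace X - \<Union>{?N}) {?N}}"] conjI ballI)
  show "good \<C>" if "\<C> \<in> {insert (topspace X - \<Union>{?N}) {?N}}" for \<C>
    using that good_cover[OF level, of "{?N}"] openin_basic[OF assms] by (simp add: sigma0_1_iff)
  show "settles {insert (topspace X - \<Union>{?N}) {?N}} ?N"
    unfolding settles_def
  proof (intro allI impI conjI)
    fix F x assume meets: "meets F {insert (topspace X - \<Union>{?N}) {?N}}" and sh: "shadows F x"
    then have X: "eventually (\<lambda>y. y \<in> topspace X) F" by (simp add: shadows_def)
    show "eventually (\<lambda>y. y \<in> ?N) F" if "x \<in> ?N"
      using that shadows_eventually_subset[OF sh assms] X by (simp add: eventually_conj_iff)
    show "eventually (\<lambda>y. y \<notin> ?N) F" if "x \<notin> ?N"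
    proof -
      have "\<not> N \<subseteq> h x" using that sh by (simp add: shadows_def)
      then have "\<not> eventually (\<lambda>y. y \<in> ?N) F"
        using shadows_eventually_subset[OF sh assms] by (simp add: eventually_conj_iff)
      then have "eventually (\<lambda>y. y \<in> topspace X - ?N) F" using meets by (simp add: meets_def)
      then show ?thesis by eventually_elim blast
    qed
  qed
qed simp

lemma settled_Diff:
  assumes "settled S" "settled S'"
  shows "settled (S - S')"
proof -
  obtain \<K> \<K>' where K: "countable \<K>" "\<forall>\<C>\<in>\<K>. good \<C>" "settles \<K> S"
    "countable \<K>'" "\<forall>\<C>\<in>\<K>'. good \<C>" "settles \<K>' S'"
    using assms unfolding settled_def by blast
  have "settles (\<K> \<union> \<K>') (S - S')"
    unfolding settles_def
  proof (intro allI impI)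
    fix F x assume "meets F (\<K> \<union> \<K>')" and sh: "shadows F x"
    then have "meets F \<K>" "meets F \<K>'" by (auto intro: meets_mono)
    then have "x \<in> S \<longrightarrow> eventually (\<lambda>y. y \<in> S) F" "x \<notin> S \<longrightarrow> eventually (\<lambda>y. y \<notin> S) F"
      "x \<in> S' \<longrightarrow> eventually (\<lambda>y. y \<in> S') F" "x \<notin> S' \<longrightarrow> eventually (\<lambda>y. y \<notin> S') F"
      using K(3,6) sh by (simp_all add: settles_def)
    moreover have "eventually (\<lambda>y. y \<notin> S - S') F" if "eventually (\<lambda>y. y \<notin> S) F"
      using that by eventually_elim blast
    moreover have "eventually (\<lambda>y. y \<notin> S - S') F" if "eventually (\<lambda>y. y \<in> S') F"
      using that by eventually_elim blast
    ultimately show "(x \<in> S - S' \<longrightarrow> eventually (\<lambda>y. y \<in> S - S') F)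
        \<and> (x \<notin> S - S' \<longrightarrow> eventually (\<lambda>y. y \<notin> S - S') F)"
      by (auto simp: eventually_conj_iff)
  qed
  then show ?thesis unfolding settled_def using K by (intro exI[of _ "\<K> \<union> \<K>'"]) auto
qed

text \<open>If \<open>x\<close> is outside all \<open>S\<^sub>n\<close>, the filter rejects each of them but might still accept their
  union. The covering that asks for a witness excludes this.\<close>

lemma settled_UN:
  assumes "a < k" "\<And>n::nat. sigma0 X a (S n)" "\<And>n. settled (S n)"
  shows "settled (\<Union>n. S n)"
proof -
  have "\<forall>n. \<exists>\<K>. countable \<K> \<and> (\<forall>\<C>\<in>\<K>. good \<C>) \<and> settles \<K> (S n)"
    using assms(3) unfolding settled_def by blast
  then obtain \<K> where K: "\<And>n. countable (\<K> n)" "\<And>n. \<forall>\<C>\<in>\<K> n. good \<C>" "\<And>n. settles (\<K> n) (S n)"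
    by metis
  let ?c = "insert (topspace X - \<Union>(range S)) (range S)"
  have "good ?c" using assms(2) by (intro good_cover[OF assms(1)]) auto
  have "settles (insert ?c (\<Union>n. \<K> n)) (\<Union>n. S n)"
    unfolding settles_def
  proof (intro allI impI conjI)
    fix F x assume meets: "meets F (insert ?c (\<Union>n. \<K> n))" and sh: "shadows F x"
    have "meets F (\<K> n)" for n by (rule meets_mono[OF meets]) auto
    then have S: "x \<in> S n \<longrightarrow> eventually (\<lambda>y. y \<in> S n) F"
      "x \<notin> S n \<longrightarrow> eventually (\<lambda>y. y \<notin> S n) F" for n
      using K(3)[of n] sh by (simp_all add: settles_def)
    show "eventually (\<lambda>y. y \<in> (\<Union>n. S n)) F" if x: "x \<in> (\<Union>n. S n)"
    proof -
      obtain n where "x \<in> S n" using x by blast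
      then have "eventually (\<lambda>y. y \<in> S n) F" using S by blast
      then show ?thesis by eventually_elim blast
    qed
    show "eventually (\<lambda>y. y \<notin> (\<Union>n. S n)) F" if "x \<notin> (\<Union>n. S n)"
    proof -
      have "eventually (\<lambda>y. y \<notin> S n) F" for n using S that by blast
      then have "\<not> eventually (\<lambda>y. y \<in> S n) F" for n
        using shadows_eventually_not[OF sh] by blast
      then have "eventually (\<lambda>y. y \<in> topspace X - (\<Union>n. S n)) F"
        using meets unfolding meets_def by auto
      then show ?thesis by eventually_elim blast
    qed
  qed
  then show ?thesis unfolding settled_def using K(1,2) \<open>good ?c\<close>
    by (intro exI[of _ "insert ?c (\<Union>n. \<K> n)"]) auto
qed

lemma settled_openin:
  assumes "openin X S"
  shows "settled S"
proof -
  have top: "settled (topspace X)" using settled_basic[of "{}"] by simp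
  obtain \<F> where \<F>: "\<F> \<subseteq> Collect finite" "S = {x \<in> topspace X. \<exists>F\<in>\<F>. F \<subseteq> h x}"
    using assms unfolding openin_iff by (elim exE conjE)
  show ?thesis
  proof (cases "\<F> = {}")
    case True
    then have "S = topspace X - topspace X" using \<F> by simp
    then show ?thesis using settled_Diff[OF top top] by simp
  next
    case False
    have "countable \<F>"
      using \<F>(1) countable_Collect_finite countable_subset by blast
    define N where "N = from_nat_into \<F>"
    have N: "range N = \<F>" using False \<open>countable \<F>\<close> by (simp add: N_def range_from_nat_into)
    then have fin: "finite (N n)" for n using \<F>(1) by blast
    have "S = (\<Union>n. {x \<in> topspace X. N n \<subseteq> h x})" unfolding \<F>(2) N[symmetric] by auto
    moreover have "settled (\<Union>n. {x \<in> topspace X. N n \<subseteq> h x})"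
      using fin by (intro settled_UN[OF level]) (auto simp: sigma0_1_iff openin_basic settled_basic)
    ultimately show ?thesis by (simp only:)
  qed
qed

lemma settled_sigma0: "sigma0 X a S \<Longrightarrow> a < k \<Longrightarrow> settled S"
proof (induction rule: sigma0.induct)
  case (1 U)
  then show ?case by (intro settled_openin)
next
  case (2 U V)
  show ?case
  proof (rule settled_UN[OF 2(3)])
    show "sigma0 X (1 + 1) (U n - V n)" for n
      using sigma0.intros(2)[of X "\<lambda>_. U n" "\<lambda>_. V n"] 2(1,2) by simp
    show "settled (U n - V n)" for n using 2(1,2) by (intro settled_Diff settled_openin)
  qed
next
  case (3 a B)
  show ?case
  proof (rule settled_UN[OF 3(3)])
    fix n
    obtain b where b: "b < a" "sigma0 X b (B n)" "b < k \<longrightarrow> settled (B n)"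
      using 3(2)[of n] by blast
    show "sigma0 X a (topspace X - B n)" using b by (intro sigma0_compl)
    have "settled (B n)" using b(3) order.strict_trans[OF b(1) 3(3)] by blast
    then show "settled (topspace X - B n)" by (rule settled_Diff[OF settled_openin[OF openin_topspace]])
  qed
qed

text \<open>Splitting along sets of level \<open>k\<close> itself is not available, so settling does not extend to
  them. They are nevertheless unions of settled sets, and this suffices for the fibres of \<open>A\<close>.\<close>

lemma sigma0_union_of_settled:
  assumes "sigma0 X k S"
  obtains D where "\<And>n::nat. settled (D n)" "S = (\<Union>n. D n)"
proof -
  from sigma0_ge_1[OF assms] show thesis
  proof (cases rule: omega1_level_cases)
    case two
    from assms[unfolded two] obtain U V where
      "\<And>n::nat. openin X (U n)" "\<And>n. openin X (V n)" "S = (\<Union>n. U n - V n)"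
      by (rule sigma0_2E) (rule that)
    then show thesis by (intro that[of "\<lambda>n. U n - V n"] settled_Diff settled_openin)
  next
    case more
    from assms more obtain B where
      B: "\<And>n::nat. \<exists>b<k. sigma0 X b (B n)" "S = (\<Union>n. topspace X - B n)"
      by (rule sigma0_gt_2E) (rule that)
    have "settled (topspace X - B n)" for n
    proof (rule settled_Diff[OF settled_openin[OF openin_topspace]])
      show "settled (B n)" using B(1)[of n] settled_sigma0 by blast
    qed
    then show thesis using B(2) by (rule that)
  qed (use level in simp)
qed

text \<open>The coverings used are those that settle countably many pieces of the fibres of \<open>A\<close>, where
  countability of the range enters, and for each \<open>k\<close> one that turns acceptance of the premise
  \<open>\<U> k\<close> into acceptance of one basic open set from \<open>\<V> k\<close>. By the latter the set of coordinates
  accepted by the filter satisfies all implications that define the image of \<open>h\<close>, so it comes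
  from a point.\<close>

lemma holds_for_partition:
  fixes A :: "'x \<Rightarrow> 'q" and \<U> \<V> :: "nat \<Rightarrow> nat set set"
  assumes fin: "\<And>k. \<U> k \<subseteq> Collect finite" "\<And>k. \<V> k \<subseteq> Collect finite"
    and image: "h ` topspace X = {I. \<forall>k. (\<exists>F\<in>\<U> k. F \<subseteq> I) \<longrightarrow> (\<exists>F\<in>\<V> k. F \<subseteq> I)}"
    and const: "\<And>q Y. Y \<subseteq> topspace X \<Longrightarrow> \<forall>x\<in>Y. A x = q \<Longrightarrow> P Y"
    and A: "countable (A ` topspace X)" "\<And>q. sigma0 X k {x \<in> topspace X. A x = q}"
  shows "P (topspace X)"
proof (rule ccontr)
  assume not: "\<not> P (topspace X)"
  have "\<exists>D. (\<forall>n::nat. settled (D n)) \<and> {x \<in> topspace X. A x = q} = (\<Union>n. D n)" for q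
    by (rule sigma0_union_of_settled[OF A(2)[of q]]) blast
  then obtain D where D: "\<And>q n. settled (D q n)"
    "\<And>q. {x \<in> topspace X. A x = q} = (\<Union>n::nat. D q n)" by metis
  obtain \<K> where K: "\<And>q n. countable (\<K> q n)" "\<And>q n. \<forall>\<C>\<in>\<K> q n. good \<C>"
    "\<And>q n. settles (\<K> q n) (D q n)" using D(1) unfolding settled_def by metis
  define N where "N G = {x \<in> topspace X. G \<subseteq> h x}" for G
  let ?c = "\<lambda>k. insert (topspace X - \<Union>(N ` \<V> k)) (N ` \<V> k)"
  have good_c: "good (?c k)" for k
  proof (rule good_cover[OF level])
    have "countable (\<V> k)" using fin(2) countable_Collect_finite countable_subset by blast
    then show "countable (N ` \<V> k)" by simp
    show "sigma0 X 1 S" if "S \<in> N ` \<V> k" for S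
      using that fin(2) openin_basic unfolding sigma0_1_iff N_def by blast
  qed
  let ?K = "range ?c \<union> (\<Union>q\<in>A ` topspace X. \<Union>n. \<K> q n)"
  have cnt: "countable ?K" by (intro countable_Un countable_UN A(1) K(1)) simp_all
  have good: "good \<C>" if "\<C> \<in> ?K" for \<C> using that good_c K(2) by blast
  obtain F where F: "F \<noteq> bot" "eventually (\<lambda>x. x \<in> topspace X) F" "meets F ?K"
    "\<And>Z. eventually (\<lambda>x. x \<in> Z) F \<Longrightarrow> \<exists>Y. Y \<subseteq> topspace X \<inter> Z \<and> \<not> P Y"
    by (rule generic_filter[OF cnt _ not]) (erule good, rule that)
  define I where "I = {n. eventually (\<lambda>y. n \<in> h y) F}"
  have "I \<in> h ` topspace X"
    unfolding image
  proof (intro CollectI allI impI)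
    fix k assume "\<exists>G\<in>\<U> k. G \<subseteq> I"
    then obtain G where G: "G \<in> \<U> k" "G \<subseteq> I" by blast
    then have "finite G" using fin(1) by blast
    then have "eventually (\<lambda>y. \<forall>n\<in>G. n \<in> h y) F"
      using G(2) unfolding I_def by (intro eventually_ball_finite) auto
    then have ev: "eventually (\<lambda>y. y \<in> \<Union>(N ` \<V> k)) F"
      using F(2)
    proof eventually_elim
      case (elim y)
      then have "h y \<in> h ` topspace X" "G \<subseteq> h y" by auto
      then have "\<exists>G\<in>\<V> k. G \<subseteq> h y" using G(1) unfolding image by blast
      then show ?case using elim unfolding N_def by blast
    qed
    have "\<not> eventually (\<lambda>y. y \<in> topspace X - \<Union>(N ` \<V> k)) F"
    proof
      assume "eventually (\<lambda>y. y \<in> topspace X - \<Union>(N ` \<V> k)) F"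
      with ev have "eventually (\<lambda>y. False) F" by eventually_elim blast
      then show False using F(1) by simp
    qed
    moreover have "\<exists>C\<in>?c k. eventually (\<lambda>y. y \<in> C) F" using F(3) unfolding meets_def by blast
    ultimately obtain H where H: "H \<in> \<V> k" "eventually (\<lambda>y. y \<in> N H) F" by blast
    have "eventually (\<lambda>y. n \<in> h y) F" if "n \<in> H" for n
      using H(2) by eventually_elim (use that in \<open>auto simp: N_def\<close>)
    then show "\<exists>G\<in>\<V> k. G \<subseteq> I" using H(1) unfolding I_def by blast
  qed
  then obtain x where x: "x \<in> topspace X" "h x = I" by blast
  have sh: "shadows F x" unfolding shadows_def using F(1,2) x by (simp add: I_def)
  obtain n where n: "x \<in> D (A x) n" using D(2)[of "A x"] x(1) by blast
  have "\<K> (A x) n \<subseteq> ?K" using x(1) by blast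
  then have "meets F (\<K> (A x) n)" by (rule meets_mono[OF F(3)])
  then have "eventually (\<lambda>y. y \<in> D (A x) n) F"
    using K(3)[of "A x" n] sh n unfolding settles_def by blast
  then obtain Y where Y: "Y \<subseteq> topspace X \<inter> D (A x) n" "\<not> P Y" using F(4) by blast
  moreover have "\<forall>y\<in>Y. A y = A x" using Y(1) D(2)[of "A x"] by blast
  ultimately show False using const by blast
qed

end

section \<open>The Hausdorff--Kuratowski theorem and the Wadge property\<close>

text \<open>The levels available after the shift by \<open>b\<close> are cofinal below \<open>1 + (b + \<omega>\<^sup>g)\<close>.\<close>

lemma level_below_shift:
  assumes "a < 1 + (b + omega_pow g)"
  obtains d where "d < omega_pow g" "a \<le> 1 + (b + d)"
proof -
  from assms have "a < (1 + b) + omega_pow g" by (simp add: ord_add_assoc)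
  then consider "a < 1 + b" | d where "d < omega_pow g" "a \<le> 1 + b + d"
    using ord_add_approx by blast
  then show thesis
  proof cases
    case 1
    then show thesis using that[of 0] omega_pow_pos by (simp add: less_imp_le)
  next
    case 2
    then show thesis using that[of d] by (simp add: ord_add_assoc)
  qed
qed

lemma realisable_of_sigma0:
  fixes A :: "'x \<Rightarrow> 'q"
  assumes "quasi_polish X" "countable (A ` topspace X)"
    "\<And>q. sigma0 X (1 + (b + omega_pow g)) {x \<in> topspace X. A x = q}"
  shows "realisable g (shift b (borel_base X)) A (topspace X)"
proof -
  let ?L = "shift b (borel_base X)" and ?k = "1 + (b + omega_pow g)"
  have base: "base_on (topspace X) ?L" by (rule base_on_shift[OF base_on_borel])
  have bound: "\<exists>ds. set ds \<subseteq> {..<g} \<and> (\<forall>S. sigma0 X a S \<longrightarrow> S \<in> ?L (sum_pows ds))"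
    if "a < ?k" for a
  proof -
    obtain d where d: "d < omega_pow g" "a \<le> 1 + (b + d)" using \<open>a < ?k\<close> by (rule level_below_shift)
    obtain ds where ds: "set ds \<subseteq> {..<g}" "d \<le> sum_pows ds" using sum_pows_cofinal[OF d(1)] .
    have "a \<le> 1 + (b + sum_pows ds)"
      using d(2) omega1_add_mono[OF omega1_add_mono[OF ds(2)], of 1 b] by order
    then have "\<forall>S. sigma0 X a S \<longrightarrow> S \<in> ?L (sum_pows ds)"
      using sigma0_le_mono by (auto simp: shift_def borel_base_def)
    then show ?thesis using ds(1) by blast
  qed
  from assms(1) obtain h :: "'x \<Rightarrow> nat set" and \<U> \<V> :: "nat \<Rightarrow> nat set set" where pres:
    "\<And>S. openin X S \<longleftrightarrow>
       (\<exists>\<F>. \<F> \<subseteq> Collect finite \<and> S = {x \<in> topspace X. \<exists>F\<in>\<F>. F \<subseteq> h x})"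
    and fin: "\<And>k. \<U> k \<subseteq> Collect finite" "\<And>k. \<V> k \<subseteq> Collect finite"
    and image: "h ` topspace X = {I. \<forall>k. (\<exists>F\<in>\<U> k. F \<subseteq> I) \<longrightarrow> (\<exists>F\<in>\<V> k. F \<subseteq> I)}"
    by (rule quasi_polish_presentation) (rule that)
  interpret split_closed X h ?k "realisable g ?L A"
  proof
    have "0 < b + omega_pow g"
      using omega_pow_pos[of g] ord_le_add_left[of "omega_pow g" b] by order
    then show "1 < ?k" using ord_add_less_mono[of 0 _ 1] by simp
    show "realisable g ?L A {}" by (rule realisable_const) simp
    fix a S Y assume "a < ?k" "sigma0 X a S" and Y: "Y \<subseteq> topspace X"
      "realisable g ?L A (Y \<inter> S)" "realisable g ?L A (Y - S)"
    then obtain ds where ds: "set ds \<subseteq> {..<g}" "S \<in> ?L (sum_pows ds)" using bound by blast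
    show "realisable g ?L A Y" by (rule realisable_split[OF base Y(1) ds Y(2,3)])
  next
    fix a Y and R :: "nat \<Rightarrow> 'x set"
    assume "a < ?k" "\<And>n. sigma0 X a (R n)" and Y: "Y \<subseteq> topspace X"
      "\<And>n. realisable g ?L A (Y \<inter> R n)"
    then obtain ds where ds: "set ds \<subseteq> {..<g}" "\<And>n. R n \<in> ?L (sum_pows ds)"
      using bound by meson
    show "realisable g ?L A (Y \<inter> (\<Union>n. R n))" by (rule realisable_UN[OF base Y(1) ds Y(2)])
  qed (rule pres)
  show ?thesis
    by (rule holds_for_partition[OF fin image _ assms(2,3)]) (rule realisable_const)
qed

text \<open>Under flattening, a constant that is itself a term turns into an application of \<open>s\<close>; so the
  first summands of the normal form can be used just to shift the base.\<close>

lemma foldr_Sh_nf_terms: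
  "u \<in> omega_terms g UNIV \<Longrightarrow> foldr Sh es u \<in> nf_terms (es @ [g])"
proof (induction es)
  case (Cons e es)
  obtain f fs where es: "es @ [g] = f # fs" by (cases es) auto
  have "Const (foldr Sh es u) \<in> omega_terms e (nf_terms (es @ [g]))"
    using Cons by (intro omega_terms.intros) simp
  then have "flatten e (Const (foldr Sh es u)) \<in> nf_terms (e # es @ [g])"
    unfolding es nf_terms.simps by (rule imageI)
  then show ?case by simp
qed simp

text \<open>Complements of fibres are preimages as well, which is the reason for bounding the preimages
  of all sets of values and not just those of points.\<close>

theorem terms_at_determine_delta0_partitions:
  fixes X :: "'x topology"
  assumes "quasi_polish X" "0 < a"
  shows "(\<Union>T \<in> terms_at a. determined X T) =
    {A \<in> delta0_partitions X (1 + a) :: ('x \<Rightarrow> 'q) set. countable (A ` topspace X)}"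
proof (intro equalityI subsetI)
  fix A :: "'x \<Rightarrow> 'q" assume "A \<in> (\<Union>T \<in> terms_at a. determined X T)"
  then obtain es u where u: "cantor_nf a es" "u \<in> nf_terms es" "A \<in> determined X u"
    unfolding terms_at_def by blast
  have a: "a = sum_pows es" using u(1) by (simp add: cantor_nf_def sum_pows_def)
  then have "es \<noteq> []" using \<open>0 < a\<close> by auto
  have real: "A \<in> topspace X \<rightarrow>\<^sub>E UNIV" "realises u (topspace X) (borel_base X) A"
    using u(3) by (simp_all add: determined_iff_realises)
  have "preimages_in (borel_base X a) (topspace X) A"
    unfolding a by (rule has_levelD[OF has_level_nf_terms[OF u(2) \<open>es \<noteq> []\<close>] base_on_borel real(2)])
  then have sig: "sigma0 X (1 + a) {x \<in> topspace X. A x \<in> Z}" for Z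
    by (simp add: preimages_in_def borel_base_def)
  have "delta0 X (1 + a) {x \<in> topspace X. A x = q}" for q
  proof -
    have "topspace X - {x \<in> topspace X. A x = q} = {x \<in> topspace X. A x \<in> - {q}}" by auto
    then show ?thesis unfolding delta0_def using sig[of "{q}"] sig[of "- {q}"] by simp
  qed
  then show "A \<in> {A \<in> delta0_partitions X (1 + a). countable (A ` topspace X)}"
    using real realises_countable_range[OF base_on_borel] by (simp add: delta0_partitions_def)
next
  fix A :: "'x \<Rightarrow> 'q"
  assume "A \<in> {A \<in> delta0_partitions X (1 + a). countable (A ` topspace X)}"
  then have ext: "A \<in> topspace X \<rightarrow>\<^sub>E UNIV" and cnt: "countable (A ` topspace X)"
    and sig: "\<And>q. sigma0 X (1 + a) {x \<in> topspace X. A x = q}"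
    by (auto simp: delta0_partitions_def delta0_def)
  obtain es where es: "cantor_nf a es" using cantor_nf_exists by blast
  then have a: "a = sum_pows es" by (simp add: cantor_nf_def sum_pows_def)
  then have "es \<noteq> []" using \<open>0 < a\<close> by auto
  then obtain fs g where fs: "es = fs @ [g]" using rev_exhaust by blast
  then have a': "a = sum_pows fs + omega_pow g" using a by (simp add: sum_pows_append)
  have "realisable g (shift (sum_pows fs) (borel_base X)) A (topspace X)"
    using sig unfolding a' by (rule realisable_of_sigma0[OF assms(1) cnt])
  then obtain u where u: "u \<in> omega_terms g UNIV"
    "realises u (topspace X) (shift (sum_pows fs) (borel_base X)) A"
    unfolding realisable_def restrict_self[OF base_on_shift[OF base_on_borel]] by blast
  have "foldr Sh fs u \<in> terms_at a"
    using foldr_Sh_nf_terms[OF u(1), of fs] es unfolding terms_at_def fs by blast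
  moreover have "A \<in> determined X (foldr Sh fs u)"
    using u(2) ext by (simp add: determined_iff_realises realises_foldr_Sh_iff)
  ultimately show "A \<in> (\<Union>T \<in> terms_at a. determined X T)" by blast
qed

theorem theorem8:
  fixes X :: "'x topology"
  assumes "quasi_polish X"
  shows "(\<forall>\<alpha>. (\<Union>T \<in> terms_at (\<alpha> + 1). determined X T) =
              {A \<in> delta0_partitions X (1 + \<alpha> + 1) :: ('x \<Rightarrow> 'q::preorder) set.
                 countable (A ` topspace X)})
       \<and> (\<forall>l. is_limit l \<longrightarrow>
            (\<Union>T \<in> terms_at l. determined X T) =
              {A \<in> delta0_partitions X l :: ('x \<Rightarrow> 'q) set.
                 countable (A ` topspace X)})"
proof (intro conjI allI impI)
  fix \<alpha> :: omega1
  have "0 < \<alpha> + 1" by (simp add: omega1_less_add_one_iff)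
  then show "(\<Union>T \<in> terms_at (\<alpha> + 1). determined X T) =
              {A \<in> delta0_partitions X (1 + \<alpha> + 1) :: ('x \<Rightarrow> 'q) set.
                 countable (A ` topspace X)}"
    using terms_at_determine_delta0_partitions[OF assms, of "\<alpha> + 1"] by (simp add: omega1_add_succ)
next
  fix l assume "is_limit l"
  then have "0 < l" "1 + l = l" by (simp_all add: is_limit_def one_add_limit)
  then show "(\<Union>T \<in> terms_at l. determined X T) =
              {A \<in> delta0_partitions X l :: ('x \<Rightarrow> 'q) set. countable (A ` topspace X)}"
    using terms_at_determine_delta0_partitions[OF assms, of l] by simp
qed

end
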